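(* Let $J\in L^1(\mathbb{R}^n)$ and suppose there are $0<r<\infty$ and $\mu:[0,\infty)\to[0,\infty)$ such that: $J(z)=\mu(|z|)$ for all $z\neq 0$; $\mu(\rho)=0$ for all $\rho\ge r$; $\mu(\rho_1)\le\mu(\rho_2)$ whenever $0<\rho_2<\rho_1\le r$; and one of the following holds: (a) $J=\chi_{B_r}$, or (b) $\mu$ is continuously differentiable on $[0,r]$, $\mu(r)=0$, and $\mu'(\rho)<0$ for all $0<\rho<r$. Let $\Omega\subseteq\mathbb{R}^n$ be an open bounded connected set such that: (1) for any $x=(\widehat{x},x_n),\,y=(\widehat{y},y_n)\in\partial\Omega$ with $\widehat{x}=\widehat{y}$, $x_n<y_n$ and $\theta x+(1-\theta)y\in\overline{\Omega}$ for all $0\le\theta\le1$, one has $H^J_\Omega(x)\le H^J_\Omega(y)$; (2) $\partial\Omega$ has zero $\mathcal{H}^n$-measure; (3) for each $\widehat{x}\in\pi(\overline{\Omega})$, the set $\{x_n\in\mathbb{R}:(\widehat{x},x_n)\in\overline{\Omega}\}$ is a countable union of closed intervals; (4) in case (a), $\mathcal{H}^{n-1}(\partial B_r(x)\cap\Omega)>0$ for every $x\in\partial\Omega$. Then there is a $\lambda_0\in\mathbb{R}$ such that $\Omega$ is symmetric across the hyperplane $\{(\widehat{x},x_n)\in\mathbb{R}^n: x_n=\lambda_0\}$.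
   Context: Points of $\mathbb{R}^n$ are written $x=(\widehat{x},x_n)\in\mathbb{R}^{n-1}\times\mathbb{R}$, and $\pi(\widehat{x},x_n)=\widehat{x}$ is the projection. $B_r(x)$ is the open ball of radius $r$ centered at $x$, $B_r=B_r(0)$, and $\chi_A$ is the characteristic function of $A$. $\mathcal{H}^k$ is $k$-dimensional Hausdorff measure. Closed intervals may be degenerate (single points). The nonlocal curvature of a measurable set $\Omega\subseteq\mathbb{R}^n$ at $x\in\mathbb{R}^n$ is $$H^J_\Omega(x)=\int_{\mathbb{R}^n}J(x-y)\,\bigl(\chi_{\Omega^c}(y)-\chi_\Omega(y)\bigr)\,dy .$$ *)

theory Defs
  imports "HOL-Analysis.Analysis"
begin

text \<open>
  Euclidean space of dimension \<open>n\<close> is \<open>real ^ 'n\<close> with \<open>n = CARD('n)\<close>, so that \<open>n = 1\<close> is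
  included. A distinguished index \<open>k\<close> plays the role of the last coordinate: \<open>x $ k\<close> is
  \<open>x\<^sub>n\<close>, and the space of dimension \<open>n - 1\<close> consists of the functions on the remaining
  indices, extensional outside \<open>- {k}\<close>.
\<close>

definition hat :: "'n \<Rightarrow> real ^ 'n \<Rightarrow> 'n \<Rightarrow> real" where
  "hat k x = restrict (\<lambda>i. x $ i) (- {k})"

definition join :: "'n \<Rightarrow> ('n \<Rightarrow> real) \<Rightarrow> real \<Rightarrow> real ^ 'n" where
  "join k w t = (\<chi> i. if i = k then t else w i)"

lemma join_hat: "join k (hat k x) (x $ k) = x"
  by (simp add: join_def hat_def vec_eq_iff)

lemma hat_join: "w \<in> extensional (- {k}) \<Longrightarrow> hat k (join k w t) = w"
  by (auto simp: join_def hat_def extensional_def fun_eq_iff)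

definition symmetric_across :: "'n \<Rightarrow> real \<Rightarrow> (real ^ 'n) set \<Rightarrow> bool" where
  "symmetric_across k l A \<longleftrightarrow> (\<lambda>x. join k (hat k x) (2 * l - x $ k)) ` A = A"

definition nonlocal_curvature ::
    "(real ^ 'n \<Rightarrow> real) \<Rightarrow> (real ^ 'n) set \<Rightarrow> real ^ 'n \<Rightarrow> real" where
  "nonlocal_curvature J \<Omega> x =
     (LINT y|lebesgue. J (x - y) * (indicat_real (- \<Omega>) y - indicat_real \<Omega> y))"

text \<open>
  Hausdorff (outer) measure, with the normalization for which it agrees with Lebesgue measure
  in top dimension. The empty set is treated separately in the weight because \<open>0 ^ 0 = 1\<close>.
  Only bounded covering sets are admitted because \<open>diameter\<close> is unspecified on unbounded sets.
\<close>

definition hausdorff_weight :: "nat \<Rightarrow> 'a::metric_space set \<Rightarrow> ennreal" where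
  "hausdorff_weight d U =
     (if U = {} then 0 else ennreal (unit_ball_vol (real d) * (diameter U / 2) ^ d))"

definition hausdorff_content :: "nat \<Rightarrow> real \<Rightarrow> 'a::metric_space set \<Rightarrow> ennreal" where
  "hausdorff_content d \<delta> A =
     (INF U \<in> {U :: nat \<Rightarrow> 'a set. A \<subseteq> (\<Union>i. U i) \<and> (\<forall>i. bounded (U i) \<and> diameter (U i) \<le> \<delta>)}.
        \<Sum>i. hausdorff_weight d (U i))"

definition hausdorff_measure :: "nat \<Rightarrow> 'a::metric_space set \<Rightarrow> ennreal" where
  "hausdorff_measure d A = (SUP \<delta> \<in> {0<..}. hausdorff_content d \<delta> A)"

definition countable_union_closed_intervals :: "real set \<Rightarrow> bool" where
  "countable_union_closed_intervals S \<longleftrightarrow>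
     (\<exists>\<I>. countable \<I> \<and> (\<forall>I\<in>\<I>. \<exists>a b. a \<le> b \<and> I = {a..b}) \<and> S = \<Union>\<I>)"

text \<open>
  The derivative is taken within \<open>{0..r}\<close>, hence one-sided at the endpoints: a profile that
  vanishes beyond \<open>r\<close> may have a nonzero left derivative at \<open>r\<close>. (The library's
  \<open>C1_differentiable_on\<close> demands two-sided derivatives at the endpoints.)
\<close>

definition C1_decreasing_profile :: "real \<Rightarrow> (real \<Rightarrow> real) \<Rightarrow> bool" where
  "C1_decreasing_profile r \<mu> \<longleftrightarrow>
     (\<exists>\<mu>'. (\<forall>\<rho>\<in>{0..r}. (\<mu> has_real_derivative \<mu>' \<rho>) (at \<rho> within {0..r})) \<and>
           continuous_on {0..r} \<mu>' \<and>
           \<mu> r = 0 \<and>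
           (\<forall>\<rho>\<in>{0<..<r}. \<mu>' \<rho> < 0))"

end

(* Let C be the closure of Omega and write each vertical segment of C as {x'} x [a,b]. Averaging over
   vertical segments turns the potential V(p) = int_C J(p - y) dy into an integral over C of the
   potentials of single segments, divided by their lengths. The difference of the potential of one
   segment at the two ends of another is antisymmetric in the two segments, and its sign is that of
   the difference of their midpoints. Since V is by hypothesis no larger at the top of a segment than
   at its bottom, integrating against the midpoints shows that almost every segment has equal
   potential at the two ends of almost every other one. By continuity this holds for all pairs in
   the support S of the distribution of segments.

   A segment whose potential is strictly monotone near an end of another one must therefore have the
   same midpoint and, by the same monotonicity, there is no boundary point of Omega strictly between
   these ends. Every segment over Omega is seen in this way by some element of S, so midpoints are
   locally constant, and Omega is connected. *)

theory Submission imports Defs begin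

text \<open>Each point of C names the vertical segment through it, and the distribution of segments
  is the image of Lebesgue measure on C; dividing by lengths corrects for counting a segment once
  per point. Lengths have no positive lower bound, so integrability of the antisymmetric kernel is
  not automatic. It comes from an L1 Lipschitz bound for vertical translates of the radial kernel,
  whose linear factor cancels the length; the bound rests on monotonicity rather than smoothness,
  and so it covers the jump of the indicator. The ends of a segment depend only semicontinuously on
  the point, so almost sure identities cannot be extended point by point. The support S repairs this
  at a price: a priori several of its elements may lie over one point of Omega, and their segments
  need not be maximal. Uniqueness is recovered from being seen. For a strictly decreasing profile
  every segment over Omega sees itself. For the indicator the potential has flat stretches; strict
  monotonicity comes from one end being closer than \<open>r\<close> and the other farther, and
  condition (4) together with connectedness must supply a segment with this property.\<close>

section \<open>Potentials of vertical segments\<close>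

lemma integral_pos_if_pos_on_interval:
  fixes f :: "real \<Rightarrow> real"
  assumes f: "integrable lborel f" "\<And>s. 0 \<le> f s" and "\<alpha> < \<beta>"
    and pos: "\<And>s. \<alpha> < s \<Longrightarrow> s < \<beta> \<Longrightarrow> 0 < f s"
  shows "0 < (LINT s|lborel. f s)"
proof (rule ccontr)
  assume "\<not> ?thesis"
  moreover have "0 \<le> (LINT s|lborel. f s)" using f(2) by (intro integral_nonneg_AE AE_I2)
  ultimately have "(LINT s|lborel. f s) = 0" by linarith
  then have "AE s in lborel. f s = 0"
    using f by (subst (asm) integral_nonneg_eq_0_iff_AE) auto
  then have "AE s in lborel. s \<notin> {\<alpha><..<\<beta>}"
    by eventually_elim (use pos in force)
  then have "emeasure lborel {\<alpha><..<\<beta>} = 0"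
    by (subst (asm) AE_iff_measurable[of "{\<alpha><..<\<beta>}"]) auto
  then show False using \<open>\<alpha> < \<beta>\<close> by simp
qed

text \<open>Covers both cases of the theorem: \<open>phi\<close> decreases on the whole line, so
  that negative arguments need no side conditions, and it may jump at \<open>r\<close>, where
  continuity is not demanded.\<close>

locale radial_profile =
  fixes phi :: "real \<Rightarrow> real" and r :: real
  assumes r_pos: "0 < r"
    and antimono_phi: "antimono phi"
    and phi_eq_0: "\<And>\<rho>. r \<le> \<rho> \<Longrightarrow> phi \<rho> = 0"
    and phi_pos: "\<And>\<rho>. \<rho> < r \<Longrightarrow> 0 < phi \<rho>"
    and isCont_phi: "\<And>\<rho>. \<rho> \<noteq> r \<Longrightarrow> isCont phi \<rho>"
begin

lemma phi_le: "x \<le> y \<Longrightarrow> phi y \<le> phi x"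
  using antimono_phi by (auto simp: antimono_def)

lemma phi_nonneg: "0 \<le> phi x"
  using phi_le[of x "max x r"] phi_eq_0[of "max x r"] by simp

lemma phi_measurable[measurable]: "phi \<in> borel_measurable borel"
proof -
  have "(\<lambda>x. - phi x) \<in> borel_measurable borel"
    by (rule borel_measurable_mono) (auto simp: mono_def phi_le)
  then have "(\<lambda>x. - (- phi x)) \<in> borel_measurable borel" by measurable
  then show ?thesis by simp
qed

definition K :: "real \<Rightarrow> real \<Rightarrow> real" where
  "K u t = phi (sqrt (u\<^sup>2 + t\<^sup>2))"

lemma K_nonneg: "0 \<le> K u t"
  by (simp add: K_def phi_nonneg)

lemma K_le: "K u t \<le> phi 0"
  by (simp add: K_def phi_le)

lemma K_minus [simp]: "K u (- t) = K u t"
  by (simp add: K_def)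

lemma K_antimono: "\<bar>s\<bar> \<le> \<bar>t\<bar> \<Longrightarrow> K u t \<le> K u s"
  unfolding K_def by (rule phi_le) (simp add: abs_le_square_iff)

lemma K_eq_0: "r \<le> \<bar>t\<bar> \<Longrightarrow> K u t = 0"
proof -
  assume "r \<le> \<bar>t\<bar>"
  also have "\<bar>t\<bar> \<le> sqrt (u\<^sup>2 + t\<^sup>2)"
    by (simp add: real_le_rsqrt)
  finally show ?thesis
    unfolding K_def by (rule phi_eq_0)
qed

lemma K_measurable[measurable (raw)]:
  fixes f g :: "'a \<Rightarrow> real"
  assumes [measurable]: "f \<in> borel_measurable M" "g \<in> borel_measurable M"
  shows "(\<lambda>x. K (f x) (g x)) \<in> borel_measurable M"
  unfolding K_def by measurable

lemma K_bound: "norm (K u s) \<le> phi 0 * indicator {-r..r} s"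
  using K_nonneg[of u s] K_le[of u s] K_eq_0[of s u] phi_nonneg[of 0]
  by (auto simp: indicator_def)

lemma integrable_phi0: "integrable lborel (\<lambda>s. phi 0 * indicator {-r..r} s :: real)"
  using r_pos by (intro integrable_mult_right) (simp add: integrable_real_indicator emeasure_lborel_Icc_eq)

lemma integrable_K: "integrable lborel (K u)"
  by (rule Bochner_Integration.integrable_bound[OF integrable_phi0])
     (use K_bound[of u] phi_nonneg[of 0] in \<open>auto simp: abs_mult intro!: AE_I2\<close>)

lemma set_integrable_K: "A \<in> sets borel \<Longrightarrow> set_integrable lborel A (K u)"
  unfolding set_integrable_def by (rule integrable_mult_indicator) (auto intro: integrable_K)

text \<open>\<open>F u c d t\<close> is the integral of \<open>K u (t - s)\<close> over \<open>s\<close> from \<open>c\<close> to \<open>d\<close>: the potential of a vertical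
  segment at height \<open>t\<close> and horizontal distance \<open>u\<close>. Written with an antiderivative of the even
  function \<open>K u\<close>, its symmetries become linear identities.\<close>

definition H :: "real \<Rightarrow> real \<Rightarrow> real" where
  "H u x = (LINT s:{..x}|lborel. K u s)"

definition F :: "real \<Rightarrow> real \<Rightarrow> real \<Rightarrow> real \<Rightarrow> real" where
  "F u c d t = H u (t - c) - H u (t - d)"

lemma H_diff: "x \<le> y \<Longrightarrow> H u y - H u x = (LINT s:{x<..y}|lborel. K u s)"
proof -
  assume "x \<le> y"
  then have "{..y} = {..x} \<union> {x<..y}" "{..x} \<inter> {x<..y} = {}" by auto
  then show ?thesis
    unfolding H_def by (simp add: set_integral_Un set_integrable_K)
qed

lemma H_reflect: "H u x + H u (- x) = (LINT s|lborel. K u s)"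
proof -
  have "H u (- x) = (LINT s|lborel. indicator {..-x} s * K u s)"
    by (simp add: H_def set_lebesgue_integral_def)
  also have "\<dots> = (LINT s|lborel. indicator {..-x} (- s) * K u (- s))"
    using lborel_integral_real_affine[of "-1" "\<lambda>s. indicator {..-x} s * K u s" 0] by simp
  also have "\<dots> = (LINT s:{x<..}|lborel. K u s)"
    unfolding set_lebesgue_integral_def
  proof (rule integral_cong_AE)
    show "AE s in lborel. indicator {..-x} (- s) * K u (- s) = indicat_real {x<..} s *\<^sub>R K u s"
      using AE_lborel_singleton[of x] by eventually_elim (auto simp: indicator_def)
  qed measurable
  finally have "H u x + H u (- x) = (LINT s:{..x} \<union> {x<..}|lborel. K u s)"
    unfolding H_def by (subst set_integral_Un) (auto simp: set_integrable_K)
  also have "{..x} \<union> {x<..} = (UNIV :: real set)" by auto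
  finally show ?thesis by (simp add: set_lebesgue_integral_def)
qed

text \<open>Each side combines four values of \<open>H u\<close>, at differences between an end of
  one segment and an end of the other; \<open>H_reflect\<close> turns the arguments around and its
  constants cancel. This is the source of the antisymmetry in the two segments.\<close>

lemma F_swap: "F u c d b - F u c d a = F u a b c - F u a b d"
  using H_reflect[of u "b - c"] H_reflect[of u "b - d"] H_reflect[of u "a - c"] H_reflect[of u "a - d"]
  by (simp add: F_def)

lemma F_reflect: "F u c d (c + d - t) = F u c d t"
  using H_reflect[of u "t - c"] H_reflect[of u "t - d"] by (simp add: F_def)

lemma set_integral_K_shift:
  "(LINT s:{x<..y}|lborel. K u (s - c)) = (LINT s:{x - c<..y - c}|lborel. K u s)"
  using lborel_integral_real_affine[of 1 "\<lambda>s. indicator {x - c<..y - c} s * K u s" "- c"]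
  by (simp add: set_lebesgue_integral_def indicator_def)

lemma set_integrable_K_shift:
  assumes "A \<in> sets borel" shows "set_integrable lborel A (\<lambda>s. K u (s - c))"
proof -
  have "integrable lborel (\<lambda>s. K u (- c + 1 * s))"
    using lborel_integrable_real_affine[OF integrable_K[of u], of 1 "- c"] by simp
  then have "integrable lborel (\<lambda>s. K u (s - c))" by simp
  then show ?thesis
    unfolding set_integrable_def using assms by (intro integrable_mult_indicator) auto
qed

lemma F_diff:
  assumes "t \<le> t'"
  shows "F u c d t - F u c d t' = (LINT s:{t<..t'}|lborel. K u (s - d) - K u (s - c))"
proof -
  have "F u c d t - F u c d t' = (H u (t' - d) - H u (t - d)) - (H u (t' - c) - H u (t - c))"
    by (simp add: F_def)
  also have "\<dots> = (LINT s:{t<..t'}|lborel. K u (s - d)) - (LINT s:{t<..t'}|lborel. K u (s - c))"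
    using assms by (simp add: H_diff set_integral_K_shift)
  also have "\<dots> = (LINT s:{t<..t'}|lborel. K u (s - d) - K u (s - c))"
    by (intro set_integral_diff(2)[symmetric] set_integrable_K_shift) auto
  finally show ?thesis .
qed

text \<open>Above the midpoint a height is at least as near to \<open>d\<close> as to
  \<open>c\<close>, so the integrand in \<open>F_diff\<close> is nonnegative.\<close>

lemma F_antimono_right:
  assumes "c \<le> d" "(c + d) / 2 \<le> t" "t \<le> t'"
  shows "F u c d t' \<le> F u c d t"
proof -
  have "0 \<le> (LINT s:{t<..t'}|lborel. K u (s - d) - K u (s - c))"
    unfolding set_lebesgue_integral_def
  proof (rule integral_nonneg_AE, rule AE_I2)
    fix s show "0 \<le> indicat_real {t<..t'} s *\<^sub>R (K u (s - d) - K u (s - c))"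
    proof (cases "s \<in> {t<..t'}")
      case True
      then have "\<bar>s - d\<bar> \<le> \<bar>s - c\<bar>" using assms by (auto simp: abs_if field_simps)
      then show ?thesis using K_antimono by simp
    qed simp
  qed
  then show ?thesis using F_diff[OF assms(3), of u c d] by simp
qed

lemma F_eq_right: "F u c d t = F u c d ((c + d) / 2 + \<bar>t - (c + d) / 2\<bar>)"
proof (cases "t \<ge> (c + d) / 2")
  case False
  then have "(c + d) / 2 + \<bar>t - (c + d) / 2\<bar> = c + d - t" by (simp add: field_simps)
  then show ?thesis by (simp add: F_reflect)
qed (simp add: field_simps)

lemma F_antimono:
  assumes "c \<le> d" "\<bar>t - (c + d) / 2\<bar> \<le> \<bar>t' - (c + d) / 2\<bar>"
  shows "F u c d t' \<le> F u c d t"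
  using F_antimono_right[of c d "(c + d) / 2 + \<bar>t - (c + d) / 2\<bar>" "(c + d) / 2 + \<bar>t' - (c + d) / 2\<bar>" u]
    F_eq_right[of u c d t] F_eq_right[of u c d t'] assms by simp

lemma F_cong_dist:
  "c \<le> d \<Longrightarrow> \<bar>t - (c + d) / 2\<bar> = \<bar>t' - (c + d) / 2\<bar> \<Longrightarrow> F u c d t = F u c d t'"
  using F_antimono[of c d t t' u] F_antimono[of c d t' t u] by simp

lemma F_nonneg: "c \<le> d \<Longrightarrow> 0 \<le> F u c d t"
  unfolding F_def using H_diff[of "t - d" "t - c" u]
  by (simp add: set_lebesgue_integral_def K_nonneg)

lemma F_strict_right:
  assumes "c \<le> d" "(c + d) / 2 \<le> t" "t \<le> t'" "\<alpha> < \<beta>" "{\<alpha><..<\<beta>} \<subseteq> {t<..t'}"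
    and less: "\<And>s. s \<in> {\<alpha><..<\<beta>} \<Longrightarrow> K u (s - c) < K u (s - d)"
  shows "F u c d t' < F u c d t"
proof -
  have "0 < (LINT s|lborel. indicat_real {t<..t'} s *\<^sub>R (K u (s - d) - K u (s - c)))"
  proof (rule integral_pos_if_pos_on_interval[OF _ _ \<open>\<alpha> < \<beta>\<close>])
    have "set_integrable lborel {t<..t'} (\<lambda>s. K u (s - d) - K u (s - c))"
      by (intro set_integral_diff set_integrable_K_shift) auto
    then show "integrable lborel (\<lambda>s. indicat_real {t<..t'} s *\<^sub>R (K u (s - d) - K u (s - c)))"
      by (simp add: set_integrable_def)
    show "0 \<le> indicat_real {t<..t'} s *\<^sub>R (K u (s - d) - K u (s - c))" for s
    proof (cases "s \<in> {t<..t'}")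
      case True
      then have "\<bar>s - d\<bar> \<le> \<bar>s - c\<bar>" using assms by (auto simp: abs_if field_simps)
      then show ?thesis using K_antimono by simp
    qed simp
    fix s assume s: "\<alpha> < s" "s < \<beta>"
    then have "s \<in> {t<..t'}" using assms(5) by auto
    then show "0 < indicat_real {t<..t'} s *\<^sub>R (K u (s - d) - K u (s - c))"
      using less[of s] s by simp
  qed
  then show ?thesis using F_diff[OF assms(3), of u c d] by (simp add: set_lebesgue_integral_def)
qed

text \<open>Separates the two cases: it holds for the C1 profile and fails for the indicator. As
  \<open>\<rho>\<^sub>2\<close> may lie beyond \<open>r\<close>, it includes the drop from positive
  values to zero.\<close>

definition strict :: bool where
  "strict \<longleftrightarrow> (\<forall>\<rho>\<^sub>1 \<rho>\<^sub>2. 0 \<le> \<rho>\<^sub>1 \<longrightarrow> \<rho>\<^sub>1 < \<rho>\<^sub>2 \<longrightarrow> \<rho>\<^sub>1 < r \<longrightarrow> phi \<rho>\<^sub>2 < phi \<rho>\<^sub>1)"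

text \<open>If the ends of a segment have the distances \<open>\<rho>\<^sub>1\<close> and \<open>\<rho>\<^sub>2\<close> from a point in \<open>band\<close>, its potential is
  strictly monotone there in the vertical distance to the midpoint of the segment.\<close>

definition band :: "real \<Rightarrow> real \<Rightarrow> bool" where
  "band \<rho>\<^sub>1 \<rho>\<^sub>2 \<longleftrightarrow> min \<rho>\<^sub>1 \<rho>\<^sub>2 < r \<and> (strict \<or> r < max \<rho>\<^sub>1 \<rho>\<^sub>2)"

lemma band_commute: "band a b = band b a"
  by (simp add: band_def min.commute max.commute)

lemma band_phi_less:
  assumes "band \<rho>\<^sub>1 \<rho>\<^sub>2" "0 \<le> \<rho>\<^sub>1" "\<rho>\<^sub>1 < \<rho>\<^sub>2"
  shows "phi \<rho>\<^sub>2 < phi \<rho>\<^sub>1"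
  using assms phi_pos[of \<rho>\<^sub>1] phi_eq_0[of \<rho>\<^sub>2] by (auto simp: band_def strict_def min_def max_def)

text \<open>Openness is why \<open>band\<close> asks for a distance strictly beyond
  \<open>r\<close>: the condition persists at nearby heights in \<open>F_rigid_right\<close> and for
  nearby segments in \<open>mid_const\<close>.\<close>

lemma open_band:
  fixes f g :: "'a::topological_space \<Rightarrow> real"
  assumes "continuous_on UNIV f" "continuous_on UNIV g"
  shows "open {x. band (f x) (g x)}"
  unfolding band_def
  by (intro open_Collect_conj open_Collect_disj open_Collect_less open_Collect_const
      continuous_on_min continuous_on_max assms continuous_on_const)

text \<open>Near \<open>t\<close> and above the midpoint the integrand of \<open>F_diff\<close> is
  strictly positive, so leaving \<open>t\<close> changes the potential in either direction.\<close>

lemma F_rigid_right: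
  assumes "c < d" "(c + d) / 2 \<le> t" "(c + d) / 2 \<le> t'" "F u c d t = F u c d t'"
    and band: "band (sqrt (u\<^sup>2 + (t - c)\<^sup>2)) (sqrt (u\<^sup>2 + (t - d)\<^sup>2))"
  shows "t = t'"
proof (rule ccontr)
  assume "t \<noteq> t'"
  have "open {s. band (sqrt (u\<^sup>2 + (s - c)\<^sup>2)) (sqrt (u\<^sup>2 + (s - d)\<^sup>2))}"
    by (intro open_band continuous_intros)
  then obtain \<delta> where \<delta>: "\<delta> > 0"
    "\<And>s. \<bar>s - t\<bar> < \<delta> \<Longrightarrow> band (sqrt (u\<^sup>2 + (s - c)\<^sup>2)) (sqrt (u\<^sup>2 + (s - d)\<^sup>2))"
    using band unfolding open_dist by (auto simp: dist_real_def)
  have less: "K u (s - c) < K u (s - d)" if "\<bar>s - t\<bar> < \<delta>" "(c + d) / 2 < s" for s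
  proof -
    have "\<bar>s - d\<bar> < \<bar>s - c\<bar>" using that \<open>c < d\<close> by (auto simp: abs_if field_simps)
    then have "(s - d)\<^sup>2 < (s - c)\<^sup>2" using abs_le_square_iff[of "s - c" "s - d"] by linarith
    then show ?thesis
      unfolding K_def using \<delta>(2)[OF that(1)]
      by (intro band_phi_less) (auto simp: band_commute)
  qed
  show False
  proof (cases "t < t'")
    case True
    have "F u c d t' < F u c d t"
      by (rule F_strict_right[of c d t t' t "min t' (t + \<delta>)"])
         (use True assms \<delta> in \<open>auto intro!: less\<close>)
    then show ?thesis using assms by simp
  next
    case False
    have "F u c d t < F u c d t'"
      by (rule F_strict_right[of c d t' t "max t' (t - \<delta>)" t])
         (use False \<open>t \<noteq> t'\<close> assms \<delta> in \<open>auto intro!: less\<close>)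
    then show ?thesis using assms by simp
  qed
qed

text \<open>Reflection at the midpoint moves both heights to the upper side. It exchanges the
  distances to the two ends, in which \<open>band\<close> is symmetric.\<close>

lemma F_rigid:
  assumes "c < d" "F u c d t = F u c d t'"
    and band: "band (sqrt (u\<^sup>2 + (t - c)\<^sup>2)) (sqrt (u\<^sup>2 + (t - d)\<^sup>2))"
  shows "\<bar>t - (c + d) / 2\<bar> = \<bar>t' - (c + d) / 2\<bar>"
proof -
  let ?m = "(c + d) / 2"
  have "band (sqrt (u\<^sup>2 + (?m + \<bar>t - ?m\<bar> - c)\<^sup>2)) (sqrt (u\<^sup>2 + (?m + \<bar>t - ?m\<bar> - d)\<^sup>2))"
  proof (cases "t \<ge> ?m")
    case False
    then have "?m + \<bar>t - ?m\<bar> - c = d - t" "?m + \<bar>t - ?m\<bar> - d = c - t" by (simp_all add: field_simps)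
    then show ?thesis using band by (simp only: power2_commute[of t] band_commute)
  qed (use band in simp)
  moreover have "F u c d (?m + \<bar>t - ?m\<bar>) = F u c d (?m + \<bar>t' - ?m\<bar>)"
    using F_eq_right[of u c d t] F_eq_right[of u c d t'] assms(2) by argo
  ultimately have "?m + \<bar>t - ?m\<bar> = ?m + \<bar>t' - ?m\<bar>"
    by (intro F_rigid_right[of c d "?m + \<bar>t - ?m\<bar>" "?m + \<bar>t' - ?m\<bar>" u] assms(1)) linarith+
  then show ?thesis by simp
qed

section \<open>Joint continuity of the segment potential\<close>

lemma AE_isCont_K: "AE s in lborel. isCont phi (sqrt (u\<^sup>2 + s\<^sup>2))"
proof -
  \<comment> \<open>A vertical line meets the sphere of radius \<open>r\<close>, the only place
    where the profile may jump, at most at the heights \<open>w\<close> and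
    \<open>- w\<close>.\<close>
  define w where "w = sqrt (r\<^sup>2 - u\<^sup>2)"
  have "AE s in lborel. s \<noteq> w" "AE s in lborel. s \<noteq> - w"
    by (rule AE_lborel_singleton)+
  then show ?thesis
  proof eventually_elim
    case (elim s)
    have "sqrt (u\<^sup>2 + s\<^sup>2) \<noteq> r"
    proof
      assume "sqrt (u\<^sup>2 + s\<^sup>2) = r"
      then have "r\<^sup>2 = u\<^sup>2 + s\<^sup>2" by auto
      then have "\<bar>s\<bar> = w" by (simp add: w_def)
      then show False using elim by auto
    qed
    then show ?case by (rule isCont_phi)
  qed
qed

text \<open>Dominated convergence asks for continuity of the integrand only almost everywhere, so
  the jump of the indicator is harmless. Continuity of \<open>F\<close> in all arguments later turns
  identities between potentials into closed relations.\<close>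

lemma H_LIMSEQ:
  assumes "v \<longlonglongrightarrow> u" "y \<longlonglongrightarrow> x"
  shows "(\<lambda>n. H (v n) (y n)) \<longlonglongrightarrow> H u x"
  unfolding H_def set_lebesgue_integral_def
proof (rule integral_dominated_convergence[where w = "\<lambda>s. phi 0 * indicator {-r..r} s"])
  show "AE s in lborel. (\<lambda>n. indicat_real {..y n} s *\<^sub>R K (v n) s) \<longlonglongrightarrow> indicat_real {..x} s *\<^sub>R K u s"
    using AE_isCont_K[of u] AE_lborel_singleton[of x]
  proof eventually_elim
    case (elim s)
    have "(\<lambda>n. K (v n) s) \<longlonglongrightarrow> K u s"
      unfolding K_def by (intro isCont_tendsto_compose[OF elim(1)] tendsto_intros assms)
    moreover have "(\<lambda>n. indicat_real {..y n} s) \<longlonglongrightarrow> indicat_real {..x} s"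
    proof (rule tendsto_eventually)
      show "eventually (\<lambda>n. indicat_real {..y n} s = indicat_real {..x} s) sequentially"
      proof (cases "s < x")
        case True
        then show ?thesis using order_tendstoD(1)[OF assms(2) True]
          by (auto elim!: eventually_mono simp: indicator_def)
      next
        case False
        then have "x < s" using elim by simp
        from order_tendstoD(2)[OF assms(2) this] show ?thesis
          using \<open>x < s\<close> by (auto elim!: eventually_mono simp: indicator_def)
      qed
    qed
    ultimately show ?case by (intro tendsto_scaleR)
  qed
  show "AE s in lborel. norm (indicat_real {..y n} s *\<^sub>R K (v n) s) \<le> phi 0 * indicator {-r..r} s" for n
  proof (rule AE_I2)
    fix s
    have "norm (indicat_real {..y n} s *\<^sub>R K (v n) s) \<le> norm (K (v n) s)" by (simp add: indicator_def)
    then show "norm (indicat_real {..y n} s *\<^sub>R K (v n) s) \<le> phi 0 * indicator {-r..r} s"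
      using K_bound order_trans by blast
  qed
  show "integrable lborel (\<lambda>s. phi 0 * indicator {-r..r} s :: real)" by (rule integrable_phi0)
qed measurable

lemma continuous_on_F [continuous_intros]:
  fixes u c d t :: "'a::metric_space \<Rightarrow> real"
  assumes "continuous_on A u" "continuous_on A c" "continuous_on A d" "continuous_on A t"
  shows "continuous_on A (\<lambda>x. F (u x) (c x) (d x) (t x))"
  unfolding continuous_on_sequentially o_def
proof (intro allI ballI impI)
  fix x a assume "a \<in> A" and x: "(\<forall>n. x n \<in> A) \<and> x \<longlonglongrightarrow> a"
  have lim: "(\<lambda>n. f (x n)) \<longlonglongrightarrow> f a" if "continuous_on A f" for f :: "'a \<Rightarrow> real"
    using that \<open>a \<in> A\<close> x unfolding continuous_on_sequentially o_def by blast
  show "(\<lambda>n. F (u (x n)) (c (x n)) (d (x n)) (t (x n))) \<longlonglongrightarrow> F (u a) (c a) (d a) (t a)"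
    unfolding F_def by (intro tendsto_diff H_LIMSEQ lim assms)
qed

lemma F_measurable[measurable (raw)]:
  fixes u c d t :: "'a \<Rightarrow> real"
  assumes [measurable]: "u \<in> borel_measurable M" "c \<in> borel_measurable M"
    "d \<in> borel_measurable M" "t \<in> borel_measurable M"
  shows "(\<lambda>x. F (u x) (c x) (d x) (t x)) \<in> borel_measurable M"
proof -
  have "continuous_on UNIV (\<lambda>(u, c, d, t). F u c d t)"
    unfolding split_beta by (intro continuous_intros)
  then have "(\<lambda>(u, c, d, t). F u c d t) \<in> borel_measurable borel"
    by (rule borel_measurable_continuous_onI)
  then have "(\<lambda>x. case (u x, c x, d x, t x) of (u, c, d, t) \<Rightarrow> F u c d t) \<in> borel_measurable M"
    by (rule measurable_compose[rotated]) measurable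
  then show ?thesis by simp
qed

end

section \<open>Vertical segments of a compact set\<close>

lemma measurable_indicator_Icc [measurable (raw)]:
  fixes f g h :: "'a \<Rightarrow> real"
  assumes [measurable]: "f \<in> borel_measurable M" "g \<in> borel_measurable M" "h \<in> borel_measurable M"
  shows "(\<lambda>x. indicator {f x..g x} (h x) :: 'b::{zero_neq_one, topological_space}) \<in> borel_measurable M"
proof -
  have "(\<lambda>x. indicator {f x..g x} (h x) :: 'b) = (\<lambda>x. if f x \<le> h x \<and> h x \<le> g x then 1 else 0)"
    by (auto simp: fun_eq_iff indicator_def)
  then show ?thesis by simp
qed

text \<open>A vertical line is named by any of its points \<open>z\<close>, so that Lebesgue measure
  of the whole space serves for lines without splitting it as a product.\<close>

definition pt :: "'n \<Rightarrow> real ^ 'n \<Rightarrow> real \<Rightarrow> real ^ 'n" where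
  "pt k z s = z + (s - z $ k) *\<^sub>R axis k 1"

definition hdist :: "'n \<Rightarrow> real ^ 'n \<Rightarrow> real ^ 'n \<Rightarrow> real" where
  "hdist k x z = norm (pt k (x - z) 0)"

lemma pt_nth [simp]: "pt k z s $ k = s"
  by (simp add: pt_def)

lemma pt_pt [simp]: "pt k (pt k z s) t = pt k z t"
  by (simp add: pt_def vec_eq_iff axis_def)

lemma pt_self [simp]: "pt k z (z $ k) = z"
  by (simp add: pt_def)

lemma join_hat_eq_pt: "join k (hat k z) s = pt k z s"
  by (auto simp: join_def hat_def pt_def vec_eq_iff axis_def)

lemma hat_pt: "hat k (pt k z s) = hat k z"
  by (auto simp: hat_def pt_def axis_def fun_eq_iff restrict_def)

lemma continuous_on_pt [continuous_intros]:
  "continuous_on A f \<Longrightarrow> continuous_on A g \<Longrightarrow> continuous_on A (\<lambda>x. pt k (f x) (g x))"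
  unfolding pt_def by (intro continuous_intros)

lemma continuous_on_hdist [continuous_intros]:
  "continuous_on A f \<Longrightarrow> continuous_on A g \<Longrightarrow> continuous_on A (\<lambda>x. hdist k (f x) (g x))"
  unfolding hdist_def by (intro continuous_intros)

lemma pt_measurable [measurable (raw)]:
  fixes f :: "'a \<Rightarrow> real ^ 'n"
  assumes [measurable]: "f \<in> borel_measurable M" "g \<in> borel_measurable M"
  shows "(\<lambda>x. pt k (f x) (g x)) \<in> borel_measurable M"
proof -
  have "continuous_on UNIV (\<lambda>(z, s). pt k z s)"
    unfolding split_beta by (intro continuous_intros)
  from borel_measurable_continuous_on[OF this, of "\<lambda>x. (f x, g x)" M] show ?thesis by simp
qed

lemma vec_nth_measurable [measurable (raw)]:
  fixes f :: "'a \<Rightarrow> real ^ 'n"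
  assumes [measurable]: "f \<in> borel_measurable M"
  shows "(\<lambda>x. f x $ k) \<in> borel_measurable M"
proof -
  have "continuous_on UNIV (\<lambda>z :: real ^ 'n. z $ k)" by (intro continuous_intros)
  from borel_measurable_continuous_on[OF this assms] show ?thesis .
qed

lemma hdist_measurable [measurable (raw)]:
  fixes f :: "'a \<Rightarrow> real ^ 'n"
  assumes [measurable]: "f \<in> borel_measurable M" "g \<in> borel_measurable M"
  shows "(\<lambda>x. hdist k (f x) (g x)) \<in> borel_measurable M"
  unfolding hdist_def by measurable

lemma hdist_commute: "hdist k x z = hdist k z x"
proof -
  have "pt k (x - z) 0 = - pt k (z - x) 0" by (simp add: pt_def vec_eq_iff axis_def)
  then show ?thesis by (simp add: hdist_def)
qed

lemma hdist_pt [simp]: "hdist k (pt k x s) z = hdist k x z" "hdist k x (pt k z s) = hdist k x z"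
proof -
  have "pt k (pt k x s - z) 0 = pt k (x - z) 0" "pt k (x - pt k z s) 0 = pt k (x - z) 0"
    by (simp_all add: pt_def vec_eq_iff axis_def)
  then show "hdist k (pt k x s) z = hdist k x z" "hdist k x (pt k z s) = hdist k x z"
    by (simp_all add: hdist_def)
qed

lemma hdist_self [simp]: "hdist k x x = 0"
  by (simp add: hdist_def pt_def)

lemma dist_eq_hdist: "dist x z = sqrt ((hdist k x z)\<^sup>2 + (x $ k - z $ k)\<^sup>2)"
proof -
  define v where "v = x - z"
  have "v = pt k v 0 + (v $ k) *\<^sub>R axis k 1" by (simp add: pt_def)
  moreover have "orthogonal (pt k v 0) ((v $ k) *\<^sub>R axis k 1)"
    by (simp add: orthogonal_def inner_axis)
  ultimately have "(norm v)\<^sup>2 = (norm (pt k v 0))\<^sup>2 + (norm ((v $ k) *\<^sub>R axis k (1::real)))\<^sup>2"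
    by (metis norm_add_Pythagorean)
  then have "(dist x z)\<^sup>2 = (hdist k x z)\<^sup>2 + (x $ k - z $ k)\<^sup>2"
    by (simp add: v_def hdist_def dist_norm)
  then show ?thesis by (metis real_sqrt_abs abs_of_nonneg zero_le_dist)
qed

lemma dist_pt: "dist (pt k x t) (pt k z s) = sqrt ((hdist k x z)\<^sup>2 + (t - s)\<^sup>2)"
  by (simp add: dist_eq_hdist[of _ _ k])

section \<open>Maximal vertical segments inside a compact set\<close>

locale fibers =
  fixes C :: "(real ^ 'n) set" and k :: 'n
  assumes compact_C: "compact C"
begin

lemma C_measurable [measurable]: "C \<in> sets borel"
  using compact_C by (simp add: borel_closed compact_imp_closed)

text \<open>The heights \<open>t\<close> with \<open>fib z t\<close> form the component, containing
  \<open>z\<close>, of the vertical section of \<open>C\<close> through \<open>z\<close>. As a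
  relation between \<open>z\<close> and \<open>t\<close> this is closed, while its ends
  \<open>lo z\<close> and \<open>hi z\<close> are in general only semicontinuous in
  \<open>z\<close>.\<close>

definition fib :: "real ^ 'n \<Rightarrow> real \<Rightarrow> bool" where
  "fib z t \<longleftrightarrow> (\<forall>s\<in>closed_segment (z $ k) t. pt k z s \<in> C)"

definition lo :: "real ^ 'n \<Rightarrow> real" where
  "lo z = (if z \<in> C then Inf {t. fib z t} else 0)"

definition hi :: "real ^ 'n \<Rightarrow> real" where
  "hi z = (if z \<in> C then Sup {t. fib z t} else 0)"

lemma fib_imp: "fib z t \<Longrightarrow> z \<in> C" "fib z t \<Longrightarrow> pt k z t \<in> C"
  using ends_in_segment pt_self unfolding fib_def by metis+

lemma fib_self: "z \<in> C \<Longrightarrow> fib z (z $ k)"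
  by (simp add: fib_def)

lemma fib_pt: "fib z s \<Longrightarrow> fib (pt k z s) t \<longleftrightarrow> fib z t"
proof -
  have *: "fib (pt k z s) t" if "fib z s" "fib z t" for z s t
    using that unfolding fib_def by (fastforce simp: closed_segment_eq_real_ivl split: if_splits)
  assume s: "fib z s"
  have "fib (pt k z s) (z $ k)" using *[OF s fib_self] fib_imp(1)[OF s] by simp
  then show ?thesis using *[of "pt k z s" "z $ k" t] *[OF s, of t] by auto
qed

lemma closed_fib: "closed {(z, t). fib z t}"
proof -
  have "{(z, t). fib z t} =
    (\<Inter>\<theta>\<in>{0..1}. (\<lambda>p. pt k (fst p) ((1 - \<theta>) * fst p $ k + \<theta> * snd p)) -` C)"
    by (auto simp: fib_def closed_segment_image_interval)
  also have "closed \<dots>"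
    using compact_C by (intro closed_INT ballI closed_vimage compact_imp_closed continuous_intros)
  finally show ?thesis .
qed

lemma ex_bound: "\<exists>R. \<forall>z t. fib z t \<longrightarrow> \<bar>t\<bar> \<le> R"
proof -
  obtain R where "\<And>x. x \<in> C \<Longrightarrow> norm x \<le> R"
    using compact_C compact_imp_bounded bounded_iff by metis
  then have "\<bar>t\<bar> \<le> R" if "fib z t" for z t
    using fib_imp(2)[OF that] component_le_norm_cart[of "pt k z t" k] by fastforce
  then show ?thesis by blast
qed

lemma compact_fib: "compact {(z, t). fib z t}"
proof -
  obtain R where R: "\<And>z t. fib z t \<Longrightarrow> \<bar>t\<bar> \<le> R" using ex_bound by blast
  have "{(z, t). fib z t} \<subseteq> C \<times> {-R..R}"
    using fib_imp(1) R by (force simp: abs_le_iff)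
  then have "bounded {(z, t). fib z t}"
    using compact_C bounded_Times bounded_closed_interval bounded_subset compact_imp_bounded by metis
  with closed_fib show ?thesis by (simp add: compact_eq_bounded_closed)
qed

lemma fib_iff:
  assumes "z \<in> C" shows "fib z t \<longleftrightarrow> lo z \<le> t \<and> t \<le> hi z"
proof -
  obtain R where R: "\<And>z t. fib z t \<Longrightarrow> \<bar>t\<bar> \<le> R" using ex_bound by blast
  have "closed ((\<lambda>t. (z, t)) -` {(z, t). fib z t})"
    by (intro closed_vimage closed_fib continuous_intros)
  then have cl: "closed {t. fib z t}" by (simp add: vimage_def)
  have ne: "{t. fib z t} \<noteq> {}" using fib_self[OF assms] by blast
  have bdd: "bdd_below {t. fib z t}" "bdd_above {t. fib z t}"
    using R by (fastforce intro: bdd_belowI[of _ "-R"] bdd_aboveI[of _ R])+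
  have ends: "fib z (lo z)" "fib z (hi z)"
    using closed_contains_Inf[OF ne bdd(1) cl] closed_contains_Sup[OF ne bdd(2) cl] assms
    by (auto simp: lo_def hi_def)
  show ?thesis
  proof
    assume "fib z t"
    then show "lo z \<le> t \<and> t \<le> hi z"
      using bdd assms by (auto simp: lo_def hi_def intro: cInf_lower cSup_upper)
  next
    assume "lo z \<le> t \<and> t \<le> hi z"
    then show "fib z t"
      using ends unfolding fib_def by (auto simp: closed_segment_eq_real_ivl split: if_splits)
  qed
qed

lemma lo_le: "z \<in> C \<Longrightarrow> lo z \<le> z $ k" and le_hi: "z \<in> C \<Longrightarrow> z $ k \<le> hi z"
  using fib_self fib_iff by blast+

lemma lo_le_hi: "lo z \<le> hi z"
  using lo_le[of z] le_hi[of z] by (cases "z \<in> C") (auto simp: lo_def hi_def)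

lemma pt_in_C: "z \<in> C \<Longrightarrow> lo z \<le> s \<Longrightarrow> s \<le> hi z \<Longrightarrow> pt k z s \<in> C"
  using fib_iff fib_imp(2) by blast

lemma lo_pt: "fib z s \<Longrightarrow> lo (pt k z s) = lo z" and hi_pt: "fib z s \<Longrightarrow> hi (pt k z s) = hi z"
  using fib_imp[of z s] ext[of "fib (pt k z s)" "fib z", OF fib_pt] by (simp_all add: lo_def hi_def)

text \<open>On \<open>C\<close> a sublevel set is the projection of a compact set. The extra
  \<open>- C\<close> accounts for the default value 0 outside \<open>C\<close>.\<close>

lemma lo_measurable [measurable]: "lo \<in> borel_measurable borel"
proof (rule borel_measurable_iff_le[THEN iffD2, rule_format])
  fix \<alpha>
  have "compact (fst ` ({(z, t). fib z t} \<inter> UNIV \<times> {..\<alpha>}))"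
    by (intro compact_continuous_image continuous_intros compact_Int_closed compact_fib closed_Times
      closed_UNIV closed_atMost closed_atLeast)
  moreover have "{z \<in> space borel. lo z \<le> \<alpha>} =
      fst ` ({(z, t). fib z t} \<inter> UNIV \<times> {..\<alpha>}) \<union> (if 0 \<le> \<alpha> then - C else {})"
  proof -
    have 1: "lo z \<le> \<alpha> \<longleftrightarrow> (\<exists>t\<le>\<alpha>. fib z t)" if "z \<in> C" for z
      using fib_iff[OF that] lo_le_hi[of z] by (metis order_refl order_trans)
    have 2: "fst ` ({(z, t). fib z t} \<inter> UNIV \<times> {..\<alpha>}) = {z \<in> C. \<exists>t\<le>\<alpha>. fib z t}"
      using fib_imp(1) by (force simp: image_iff)
    have "lo z \<le> \<alpha> \<longleftrightarrow> z \<in> {z \<in> C. \<exists>t\<le>\<alpha>. fib z t} \<union> (if 0 \<le> \<alpha> then - C else {})" for z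
      using 1[of z] by (cases "z \<in> C") (simp_all add: lo_def)
    then show ?thesis unfolding 2 by (intro set_eqI) (simp only: mem_Collect_eq space_borel UNIV_I simp_thms)
  qed
  ultimately show "{z \<in> space borel. lo z \<le> \<alpha>} \<in> sets borel"
    by (auto simp: borel_closed compact_imp_closed)
qed

lemma hi_measurable [measurable]: "hi \<in> borel_measurable borel"
proof (rule borel_measurable_iff_ge[THEN iffD2, rule_format])
  fix \<alpha>
  have "compact (fst ` ({(z, t). fib z t} \<inter> UNIV \<times> {\<alpha>..}))"
    by (intro compact_continuous_image continuous_intros compact_Int_closed compact_fib closed_Times
      closed_UNIV closed_atMost closed_atLeast)
  moreover have "{z \<in> space borel. \<alpha> \<le> hi z} =
      fst ` ({(z, t). fib z t} \<inter> UNIV \<times> {\<alpha>..}) \<union> (if \<alpha> \<le> 0 then - C else {})"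
  proof -
    have 1: "\<alpha> \<le> hi z \<longleftrightarrow> (\<exists>t\<ge>\<alpha>. fib z t)" if "z \<in> C" for z
      using fib_iff[OF that] lo_le_hi[of z] by (metis order_refl order_trans)
    have 2: "fst ` ({(z, t). fib z t} \<inter> UNIV \<times> {\<alpha>..}) = {z \<in> C. \<exists>t\<ge>\<alpha>. fib z t}"
      using fib_imp(1) by (force simp: image_iff)
    have "\<alpha> \<le> hi z \<longleftrightarrow> z \<in> {z \<in> C. \<exists>t\<ge>\<alpha>. fib z t} \<union> (if \<alpha> \<le> 0 then - C else {})" for z
      using 1[of z] by (cases "z \<in> C") (simp_all add: hi_def)
    then show ?thesis unfolding 2 by (intro set_eqI) (simp only: mem_Collect_eq space_borel UNIV_I simp_thms)
  qed
  ultimately show "{z \<in> space borel. \<alpha> \<le> hi z} \<in> sets borel"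
    by (auto simp: borel_closed compact_imp_closed)
qed

text \<open>Lying on a common segment is a symmetric relation, and both points then give the same
  length. For each displacement \<open>t\<close>, translation invariance therefore allows a pair of
  points to be counted from its other member. The displacements available at \<open>w\<close> fill
  an interval of length \<open>hi w - lo w\<close>, which cancels the divisor.\<close>

lemma nn_integral_average:
  fixes f :: "real ^ 'n \<Rightarrow> ennreal"
  assumes [measurable]: "f \<in> borel_measurable borel"
    and nondegenerate: "AE z in lborel. z \<in> C \<longrightarrow> lo z < hi z"
  shows "(\<integral>\<^sup>+z. indicator C z * f z \<partial>lborel) =
    (\<integral>\<^sup>+z. indicator C z * (\<integral>\<^sup>+s. indicator {lo z..hi z} s * f (pt k z s) \<partial>lborel) / ennreal (hi z - lo z) \<partial>lborel)"
proof -
  define e :: "real ^ 'n" where "e = axis k 1"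
  \<comment> \<open>\<open>h z t\<close> is what \<open>z\<close> receives from the point at
    displacement \<open>t\<close>; \<open>g w t\<close> is the same quantity read off at that
    point.\<close>
  define h where "h z t = indicator C z * (indicator {lo z..hi z} (z $ k + t) * f (z + t *\<^sub>R e)) / ennreal (hi z - lo z)" for z t
  define g where "g w t = indicator C w * (indicator {lo w..hi w} (w $ k - t) * f w) / ennreal (hi w - lo w)" for w t
  have pt_eq: "pt k z (z $ k + t) = z + t *\<^sub>R e" for z t by (simp add: pt_def e_def)
  have e_k [simp]: "e $ k = 1" by (simp add: e_def)
  have nth: "(z + t *\<^sub>R e) $ k = z $ k + t" for z t by simp
  have hg: "h z t = g (z + t *\<^sub>R e) t" for z t
  proof (cases "fib z (z $ k + t)")
    case True
    let ?w = "z + t *\<^sub>R e"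
    have "z \<in> C" "?w \<in> C" "lo ?w = lo z" "hi ?w = hi z" "lo z \<le> z $ k + t" "z $ k + t \<le> hi z"
      "lo z \<le> z $ k" "z $ k \<le> hi z"
      using True fib_imp[OF True] lo_pt[OF True] hi_pt[OF True] fib_iff lo_le le_hi by (auto simp: pt_eq)
    then show ?thesis by (simp add: h_def g_def)
  next
    case False
    have "\<not> (z + t *\<^sub>R e \<in> C \<and> z $ k \<in> {lo (z + t *\<^sub>R e)..hi (z + t *\<^sub>R e)})"
    proof
      assume *: "z + t *\<^sub>R e \<in> C \<and> z $ k \<in> {lo (z + t *\<^sub>R e)..hi (z + t *\<^sub>R e)}"
      then have "fib (z + t *\<^sub>R e) (z $ k)" using fib_iff by auto
      moreover have "pt k (z + t *\<^sub>R e) (z $ k) = z" by (simp add: pt_eq[symmetric])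
      ultimately have "fib z (z $ k + t)"
        using fib_pt[of "z + t *\<^sub>R e" "z $ k" "z $ k + t"] fib_self[of "z + t *\<^sub>R e"] * by (simp add: nth)
      then show False using False by simp
    qed
    moreover have "\<not> (z \<in> C \<and> z $ k + t \<in> {lo z..hi z})" using False fib_iff by auto
    ultimately show ?thesis by (auto simp: h_def g_def nth indicator_def)
  qed
  have [measurable]: "(\<lambda>(z, t). h z t) \<in> borel_measurable (lborel \<Otimes>\<^sub>M lborel)"
    "(\<lambda>(z, t). g z t) \<in> borel_measurable (lborel \<Otimes>\<^sub>M lborel)"
    unfolding h_def g_def by measurable
  have "(\<integral>\<^sup>+z. indicator C z * (\<integral>\<^sup>+s. indicator {lo z..hi z} s * f (pt k z s) \<partial>lborel) / ennreal (hi z - lo z) \<partial>lborel)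
      = (\<integral>\<^sup>+z. (\<integral>\<^sup>+t. h z t \<partial>lborel) \<partial>lborel)"
  proof (rule nn_integral_cong)
    fix z
    have "(\<integral>\<^sup>+s. indicator {lo z..hi z} s * f (pt k z s) \<partial>lborel) =
        (\<integral>\<^sup>+t. indicator {lo z..hi z} (z $ k + t) * f (z + t *\<^sub>R e) \<partial>lborel)"
      using nn_integral_real_affine[of "\<lambda>s. indicator {lo z..hi z} s * f (pt k z s)" 1 "z $ k"]
      by (simp add: pt_eq)
    then show "indicator C z * (\<integral>\<^sup>+s. indicator {lo z..hi z} s * f (pt k z s) \<partial>lborel) / ennreal (hi z - lo z)
        = (\<integral>\<^sup>+t. h z t \<partial>lborel)"
      unfolding h_def by (simp add: nn_integral_cmult nn_integral_divide)
  qed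
  also have "\<dots> = (\<integral>\<^sup>+t. (\<integral>\<^sup>+z. h z t \<partial>lborel) \<partial>lborel)"
    by (rule lborel_pair.Fubini'[symmetric]) measurable
  also have "\<dots> = (\<integral>\<^sup>+t. (\<integral>\<^sup>+z. g z t \<partial>lborel) \<partial>lborel)"
  proof (rule nn_integral_cong)
    fix t :: real
    have "(\<integral>\<^sup>+z. g z t \<partial>lborel) = (\<integral>\<^sup>+z. g z t \<partial>distr lborel borel ((+) (t *\<^sub>R e)))"
      by (simp only: lborel_distr_plus)
    also have "\<dots> = (\<integral>\<^sup>+z. g (t *\<^sub>R e + z) t \<partial>lborel)"
      by (rule nn_integral_distr) measurable
    finally show "(\<integral>\<^sup>+z. h z t \<partial>lborel) = (\<integral>\<^sup>+z. g z t \<partial>lborel)"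
      by (simp add: hg add.commute)
  qed
  also have "\<dots> = (\<integral>\<^sup>+w. (\<integral>\<^sup>+t. g w t \<partial>lborel) \<partial>lborel)"
    by (rule lborel_pair.Fubini') measurable
  also have "\<dots> = (\<integral>\<^sup>+w. indicator C w * f w \<partial>lborel)"
  proof (rule nn_integral_cong_AE)
    show "AE w in lborel. (\<integral>\<^sup>+t. g w t \<partial>lborel) = indicator C w * f w"
      using nondegenerate
    proof eventually_elim
      case (elim w)
      show ?case
      proof (cases "w \<in> C")
        case True
        have "(\<integral>\<^sup>+t. g w t \<partial>lborel) =
            (\<integral>\<^sup>+t. f w / ennreal (hi w - lo w) * indicator {w $ k - hi w..w $ k - lo w} t \<partial>lborel)"
          using True by (intro nn_integral_cong) (auto simp: g_def indicator_def)
        also have "\<dots> = f w / ennreal (hi w - lo w) * ennreal (hi w - lo w)"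
          using lo_le_hi[of w] by (simp add: nn_integral_cmult_indicator)
        also have "\<dots> = f w"
          using elim True by (intro ennreal_divide_times[THEN trans]) (simp add: mult_divide_eq_ennreal)
        finally show ?thesis using True by simp
      qed (simp add: g_def)
    qed
  qed
  finally show ?thesis ..
qed

end

section \<open>Potentials of compact sets\<close>

context radial_profile
begin

definition kappa :: "real ^ 'n \<Rightarrow> real" where
  "kappa y = phi (norm y)"

lemma kappa_pt: "kappa (pt k x t - pt k z s) = K (hdist k x z) (t - s)"
  using dist_pt[of k x t z s] by (simp add: kappa_def K_def dist_norm)

lemma kappa_measurable [measurable (raw)]:
  fixes f :: "'a \<Rightarrow> real ^ 'n"
  assumes [measurable]: "f \<in> borel_measurable M"
  shows "(\<lambda>x. kappa (f x)) \<in> borel_measurable M"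
  unfolding kappa_def by measurable

lemma kappa_nonneg: "0 \<le> kappa y" and kappa_le: "kappa y \<le> phi 0"
  by (simp_all add: kappa_def phi_nonneg phi_le)

lemma kappa_bound: "norm (kappa (p - y)) \<le> phi 0 * indicator (cball p r) y"
  using kappa_nonneg[of "p - y"] kappa_le[of "p - y"]
  by (auto simp: indicator_def kappa_def dist_norm phi_eq_0)

lemma integrable_kappa: "integrable lborel (\<lambda>y. kappa (p - y))"
proof (rule Bochner_Integration.integrable_bound)
  show "integrable lborel (\<lambda>y. phi 0 * indicat_real (cball p r) y)"
    by (intro integrable_mult_right integrable_real_indicator emeasure_lborel_cball_finite) simp
  show "AE y in lborel. norm (kappa (p - y)) \<le> norm (phi 0 * indicat_real (cball p r) y)"
    using kappa_bound[of p] phi_nonneg[of 0] by (intro AE_I2) (simp add: abs_mult)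
qed simp

text \<open>Along vertical lines the kernel decreases away from its centre, so the difference has a
  constant sign on each side of the hyperplane halfway between the two centres. With
  \<open>\<sigma>\<close> for this sign, the translation moves from the kernel to
  \<open>\<sigma>\<close>, and \<open>\<sigma> y - \<sigma> (h *\<^sub>R e + y)\<close> is 2 on a
  slab of thickness \<open>h\<close> and vanishes elsewhere.\<close>

lemma kappa_shift_L1:
  fixes p :: "real ^ 'n"
  assumes "0 \<le> h"
  shows "(LINT y|lborel. \<bar>kappa (pt k p (p $ k + h) - y) - kappa (p - y)\<bar>) \<le> 2 * phi 0 * (2 * r) ^ (CARD('n) - 1) * h"
proof -
  define e :: "real ^ 'n" where "e = axis k 1"
  have e_k [simp]: "e $ k = 1" by (simp add: e_def)
  have shift: "pt k p (p $ k + h) = p + h *\<^sub>R e" by (simp add: pt_def e_def)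
  define q where "q y = kappa (p - y)" for y
  define \<sigma> where "\<sigma> y = (if y $ k \<le> p $ k + h / 2 then 1 else - 1 :: real)" for y :: "real ^ 'n"
  have [measurable]: "q \<in> borel_measurable borel" "\<sigma> \<in> borel_measurable borel"
    unfolding q_def \<sigma>_def by measurable
  have q_shift: "kappa (pt k p (p $ k + h) - y) = q (y - h *\<^sub>R e)" for y
    unfolding q_def shift by (simp add: algebra_simps)
  have abs_eq: "\<bar>q (y - h *\<^sub>R e) - q y\<bar> = q y * \<sigma> y - q (y - h *\<^sub>R e) * \<sigma> y" for y
  proof -
    have "pt k y (y $ k - h) = y - h *\<^sub>R e" by (simp add: pt_def e_def)
    then have "q (y - h *\<^sub>R e) = K (hdist k p y) (p $ k - (y $ k - h))"
      using kappa_pt[of k p "p $ k" y "y $ k - h"] by (simp add: q_def)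
    moreover have "q y = K (hdist k p y) (p $ k - y $ k)"
      using kappa_pt[of k p "p $ k" y "y $ k"] by (simp add: q_def)
    moreover have "K (hdist k p y) (p $ k - (y $ k - h)) \<le> K (hdist k p y) (p $ k - y $ k)" if "y $ k \<le> p $ k + h / 2"
      using that assms by (intro K_antimono) (auto simp: abs_if)
    moreover have "K (hdist k p y) (p $ k - y $ k) \<le> K (hdist k p y) (p $ k - (y $ k - h))" if "\<not> y $ k \<le> p $ k + h / 2"
      using that assms by (intro K_antimono) (auto simp: abs_if)
    ultimately show ?thesis by (auto simp: \<sigma>_def)
  qed
  have int_q: "integrable lborel q" unfolding q_def by (rule integrable_kappa)
  have int_q\<sigma>: "integrable lborel (\<lambda>y. q y * \<tau> y)" if [measurable]: "\<tau> \<in> borel_measurable borel" and "\<And>y. \<bar>\<tau> y\<bar> \<le> 1" for \<tau> :: "real ^ 'n \<Rightarrow> real"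
  proof (rule Bochner_Integration.integrable_bound[OF int_q])
    show "AE y in lborel. norm (q y * \<tau> y) \<le> norm (q y)"
      using that(2) by (intro AE_I2) (simp add: abs_mult mult_left_le)
  qed simp
  have [measurable]: "(\<lambda>y. \<sigma> (h *\<^sub>R e + y)) \<in> borel_measurable borel"
    by measurable
  have [simp]: "\<bar>\<sigma> y\<bar> \<le> 1" for y by (simp add: \<sigma>_def)
  have trans: "integrable lborel (\<lambda>y. q (y - h *\<^sub>R e) * \<sigma> y)"
     "(LINT y|lborel. q (y - h *\<^sub>R e) * \<sigma> y) = (LINT y|lborel. q y * \<sigma> (h *\<^sub>R e + y))"
  proof -
    have "(LINT y|lborel. q (y - h *\<^sub>R e) * \<sigma> y) = (LINT y|distr lborel borel ((+) (h *\<^sub>R e)). q (y - h *\<^sub>R e) * \<sigma> y)"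
      by (simp only: lborel_distr_plus)
    then show "(LINT y|lborel. q (y - h *\<^sub>R e) * \<sigma> y) = (LINT y|lborel. q y * \<sigma> (h *\<^sub>R e + y))"
      by (subst (asm) integral_distr) simp_all
    have "integrable (distr lborel borel ((+) (h *\<^sub>R e))) (\<lambda>y. q (y - h *\<^sub>R e) * \<sigma> y)"
      by (subst integrable_distr_eq) (auto intro: int_q\<sigma>)
    then show "integrable lborel (\<lambda>y. q (y - h *\<^sub>R e) * \<sigma> y)"
      by (simp only: lborel_distr_plus)
  qed
  \<comment> \<open>The part of the slab within distance \<open>r\<close> of \<open>p\<close> lies
    in this box, which has one side \<open>h\<close> and all others \<open>2 * r\<close>.\<close>
  define a b :: "real ^ 'n" where "a = (\<chi> i. if i = k then p $ k - h / 2 else p $ i - r)"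
    and "b = (\<chi> i. if i = k then p $ k + h / 2 else p $ i + r)"
  have "a $ i \<le> b $ i" for i using assms r_pos by (simp add: a_def b_def)
  then have "cbox a b \<noteq> {}" by (auto simp: interval_ne_empty_cart)
  then have "measure lborel (cbox a b) = (\<Prod>i\<in>UNIV. b $ i - a $ i)"
    by (simp add: content_cbox_cart)
  also have "\<dots> = h * (\<Prod>i\<in>UNIV - {k}. 2 * r)"
    by (subst prod.remove[of _ k]) (auto simp: a_def b_def intro!: prod.cong)
  finally have box: "measure lborel (cbox a b) = h * (2 * r) ^ (CARD('n) - 1)" by simp
  have int_box: "integrable lborel (indicat_real (cbox a b))"
    by (intro integrable_real_indicator emeasure_lborel_cbox_finite) simp
  have "(LINT y|lborel. \<bar>kappa (pt k p (p $ k + h) - y) - kappa (p - y)\<bar>) =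
      (LINT y|lborel. q y * \<sigma> y - q (y - h *\<^sub>R e) * \<sigma> y)"
    unfolding q_shift q_def[symmetric] by (simp only: abs_eq)
  also have "\<dots> = (LINT y|lborel. q y * \<sigma> y) - (LINT y|lborel. q y * \<sigma> (h *\<^sub>R e + y))"
    by (subst Bochner_Integration.integral_diff) (auto intro: int_q\<sigma> trans simp: trans)
  also have "\<dots> = (LINT y|lborel. q y * \<sigma> y - q y * \<sigma> (h *\<^sub>R e + y))"
    by (subst Bochner_Integration.integral_diff) (auto intro: int_q\<sigma>)
  also have "\<dots> \<le> (LINT y|lborel. 2 * phi 0 * indicator (cbox a b) y)"
  proof (rule integral_mono)
    fix y
    show "q y * \<sigma> y - q y * \<sigma> (h *\<^sub>R e + y) \<le> 2 * phi 0 * indicator (cbox a b) y"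
    proof (cases "y \<in> cball p r \<and> p $ k - h / 2 < y $ k \<and> y $ k \<le> p $ k + h / 2")
      case True
      have "\<bar>y $ i - p $ i\<bar> \<le> r" for i
        using True component_le_norm_cart[of "y - p" i] by (auto simp: dist_norm norm_minus_commute)
      then have "y \<in> cbox a b" using True by (auto simp: mem_box_cart a_def b_def abs_le_iff algebra_simps)
      moreover have "q y * \<sigma> y - q y * \<sigma> (h *\<^sub>R e + y) = 2 * q y" using True by (simp add: \<sigma>_def)
      ultimately show ?thesis using kappa_le[of "p - y"] by (simp add: q_def)
    next
      case False
      then have "q y * \<sigma> y - q y * \<sigma> (h *\<^sub>R e + y) = 0"
        using assms by (auto simp: q_def \<sigma>_def kappa_def dist_norm phi_eq_0)
      then show ?thesis unfolding \<open>_ = 0\<close> using phi_nonneg[of 0] by simp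
    qed
  qed (auto intro!: int_q\<sigma> integrable_mult_right Bochner_Integration.integrable_diff int_box)
  also have "\<dots> = 2 * phi 0 * (2 * r) ^ (CARD('n) - 1) * h" by (simp add: box)
  finally show ?thesis .
qed

lemma F_eq_integral:
  assumes "c \<le> d"
  shows "F u c d t = (LINT s|lborel. indicator {c..d} s * K u (t - s))"
    and "integrable lborel (\<lambda>s. indicator {c..d} s * K u (t - s))"
proof -
  have "integrable lborel (\<lambda>s. K u (t + (-1) * s))"
    by (intro lborel_integrable_real_affine integrable_K) simp
  then show "integrable lborel (\<lambda>s. indicator {c..d} s * K u (t - s))"
    using integrable_mult_indicator[of "{c..d}" lborel "\<lambda>s. K u (t - s)"] by simp
  have "F u c d t = (LINT s|lborel. indicator {t - d<..t - c} s * K u s)"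
    unfolding F_def using H_diff[of "t - d" "t - c" u] assms by (simp add: set_lebesgue_integral_def)
  also have "\<dots> = (LINT s|lborel. indicator {t - d<..t - c} (t - s) * K u (t - s))"
    using lborel_integral_real_affine[of "-1" "\<lambda>s. indicator {t - d<..t - c} s * K u s" t] by simp
  also have "\<dots> = (LINT s|lborel. indicator {c..d} s * K u (t - s))"
  proof (rule integral_cong_AE)
    show "AE s in lborel. indicator {t - d<..t - c} (t - s) * K u (t - s) = indicator {c..d} s * K u (t - s)"
      using AE_lborel_singleton[of d] by eventually_elim (auto simp: indicator_def)
  qed measurable
  finally show "F u c d t = (LINT s|lborel. indicator {c..d} s * K u (t - s))" .
qed

lemma nn_integral_F:
  assumes "c \<le> d"
  shows "(\<integral>\<^sup>+s. indicator {c..d} s * ennreal (K u (t - s)) \<partial>lborel) = ennreal (F u c d t)"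
proof -
  have "(\<integral>\<^sup>+s. indicator {c..d} s * ennreal (K u (t - s)) \<partial>lborel)
      = (\<integral>\<^sup>+s. ennreal (indicator {c..d} s * K u (t - s)) \<partial>lborel)"
    by (intro nn_integral_cong) (simp add: indicator_def)
  also have "\<dots> = ennreal (F u c d t)"
    unfolding F_eq_integral(1)[OF assms]
    by (intro nn_integral_eq_integral F_eq_integral(2) assms AE_I2) (simp add: K_nonneg)
  finally show ?thesis .
qed

lemma nn_integral_F_diff:
  assumes "c \<le> d"
  shows "ennreal \<bar>F u c d b - F u c d a\<bar> \<le> (\<integral>\<^sup>+s. indicator {c..d} s * ennreal \<bar>K u (b - s) - K u (a - s)\<bar> \<partial>lborel)"
proof -
  let ?f = "\<lambda>t s. indicator {c..d} s * K u (t - s)"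
  have "F u c d b - F u c d a = (LINT s|lborel. ?f b s - ?f a s)"
    by (simp add: F_eq_integral assms)
  then have "ennreal \<bar>F u c d b - F u c d a\<bar> \<le> (\<integral>\<^sup>+s. ennreal (norm (?f b s - ?f a s)) \<partial>lborel)"
    using integral_norm_bound_ennreal[of lborel "\<lambda>s. ?f b s - ?f a s"]
    by (simp add: F_eq_integral assms)
  also have "\<dots> = (\<integral>\<^sup>+s. indicator {c..d} s * ennreal \<bar>K u (b - s) - K u (a - s)\<bar> \<partial>lborel)"
    by (intro nn_integral_cong) (simp add: indicator_def)
  finally show ?thesis .
qed

end

locale profile_fibers = radial_profile phi r + fibers C k
  for phi :: "real \<Rightarrow> real" and r :: real and C :: "(real ^ 'n) set" and k :: 'n +
  assumes nondegenerate: "AE z in lborel. z \<in> C \<longrightarrow> lo z < hi z"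
begin

definition V :: "real ^ 'n \<Rightarrow> real" where
  "V p = (LINT y|lborel. indicator C y * kappa (p - y))"

text \<open>The share of the segment through \<open>z\<close> in the potential at height
  \<open>t\<close> on the line through \<open>x\<close>. Integration over \<open>z\<close> meets
  each segment once per point, hence the division by its length.\<close>

definition Q :: "real ^ 'n \<Rightarrow> real \<Rightarrow> real ^ 'n \<Rightarrow> real" where
  "Q x t z = indicator C z * F (hdist k x z) (lo z) (hi z) t / (hi z - lo z)"

lemma Q_measurable [measurable (raw)]:
  fixes f g :: "'a \<Rightarrow> real ^ 'n"
  assumes [measurable]: "f \<in> borel_measurable M" "t \<in> borel_measurable M" "g \<in> borel_measurable M"
  shows "(\<lambda>x. Q (f x) (t x) (g x)) \<in> borel_measurable M"
  unfolding Q_def by measurable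

lemma Q_nonneg: "0 \<le> Q x t z"
  using lo_le_hi[of z] by (simp add: Q_def F_nonneg)

lemma nn_integral_Q: "(\<integral>\<^sup>+z. ennreal (Q x t z) \<partial>lborel) = (\<integral>\<^sup>+y. ennreal (indicator C y * kappa (pt k x t - y)) \<partial>lborel)"
proof -
  have "(\<integral>\<^sup>+y. ennreal (indicator C y * kappa (pt k x t - y)) \<partial>lborel) =
      (\<integral>\<^sup>+y. indicator C y * ennreal (kappa (pt k x t - y)) \<partial>lborel)"
    by (intro nn_integral_cong) (simp add: indicator_def)
  also have "\<dots> = (\<integral>\<^sup>+z. indicator C z * ennreal (F (hdist k x z) (lo z) (hi z) t) / ennreal (hi z - lo z) \<partial>lborel)"
    by (subst nn_integral_average[OF _ nondegenerate]) (simp_all add: kappa_pt nn_integral_F lo_le_hi)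
  also have "\<dots> = (\<integral>\<^sup>+z. ennreal (Q x t z) \<partial>lborel)"
  proof (rule nn_integral_cong_AE)
    show "AE z in lborel. indicator C z * ennreal (F (hdist k x z) (lo z) (hi z) t) / ennreal (hi z - lo z) = ennreal (Q x t z)"
      using nondegenerate
      by eventually_elim (auto simp: Q_def indicator_def divide_ennreal F_nonneg lo_le_hi)
  qed
  finally show ?thesis ..
qed

lemma integrable_kappa_C: "integrable lborel (\<lambda>y. indicator C y * kappa (p - y))"
  using integrable_mult_indicator[of C lborel "\<lambda>y. kappa (p - y)"] by (simp add: integrable_kappa)

lemma integrable_Q: "integrable lborel (Q x t)"
  and V_eq: "V (pt k x t) = (LINT z|lborel. Q x t z)"
proof -
  have eq: "(\<integral>\<^sup>+y. ennreal (indicator C y * kappa (pt k x t - y)) \<partial>lborel) = ennreal (V (pt k x t))"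
    unfolding V_def
    by (intro nn_integral_eq_integral integrable_kappa_C AE_I2) (simp add: kappa_nonneg)
  show "integrable lborel (Q x t)"
    by (rule integrableI_nonneg) (auto simp: Q_nonneg nn_integral_Q eq)
  then have "ennreal (V (pt k x t)) = ennreal (LINT z|lborel. Q x t z)"
    unfolding eq[symmetric] nn_integral_Q[symmetric]
    by (intro nn_integral_eq_integral) (auto simp: Q_nonneg)
  then show "V (pt k x t) = (LINT z|lborel. Q x t z)"
    by (subst (asm) ennreal_inj) (auto simp: V_def kappa_nonneg Q_nonneg intro!: integral_nonneg_AE)
qed

text \<open>The triangle inequality on each segment, followed by averaging backwards, reduces this
  to \<open>kappa_shift_L1\<close>. What counts is linearity in \<open>b - a\<close>.\<close>

lemma Q_lipschitz_L1:
  assumes "a \<le> b"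
  shows "(\<integral>\<^sup>+z. ennreal \<bar>Q x b z - Q x a z\<bar> \<partial>lborel) \<le> ennreal (2 * phi 0 * (2 * r) ^ (CARD('n) - 1) * (b - a))"
proof -
  let ?d = "\<lambda>y. \<bar>kappa (pt k x b - y) - kappa (pt k x a - y)\<bar>"
  have "(\<integral>\<^sup>+z. ennreal \<bar>Q x b z - Q x a z\<bar> \<partial>lborel) \<le>
      (\<integral>\<^sup>+z. indicator C z * (\<integral>\<^sup>+s. indicator {lo z..hi z} s * ennreal (?d (pt k z s)) \<partial>lborel) / ennreal (hi z - lo z) \<partial>lborel)"
  proof (rule nn_integral_mono_AE)
    show "AE z in lborel. ennreal \<bar>Q x b z - Q x a z\<bar> \<le>
        indicator C z * (\<integral>\<^sup>+s. indicator {lo z..hi z} s * ennreal (?d (pt k z s)) \<partial>lborel) / ennreal (hi z - lo z)"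
      using nondegenerate
    proof eventually_elim
      case (elim z)
      show ?case
      proof (cases "z \<in> C")
        case True
        then have len: "0 < hi z - lo z" using elim by simp
        have "\<bar>Q x b z - Q x a z\<bar> = \<bar>F (hdist k x z) (lo z) (hi z) b - F (hdist k x z) (lo z) (hi z) a\<bar> / (hi z - lo z)"
          using True len by (simp add: Q_def diff_divide_distrib[symmetric])
        also have "ennreal \<dots> = ennreal \<bar>F (hdist k x z) (lo z) (hi z) b - F (hdist k x z) (lo z) (hi z) a\<bar> / ennreal (hi z - lo z)"
          using len by (simp add: divide_ennreal)
        finally show ?thesis
          using True nn_integral_F_diff[OF lo_le_hi[of z], of "hdist k x z" b a]
          by (simp add: kappa_pt divide_right_mono_ennreal)
      qed (simp add: Q_def)
    qed
  qed
  also have "\<dots> = (\<integral>\<^sup>+y. indicator C y * ennreal (?d y) \<partial>lborel)"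
    by (rule nn_integral_average[OF _ nondegenerate, symmetric]) simp
  also have "\<dots> \<le> (\<integral>\<^sup>+y. ennreal (?d y) \<partial>lborel)"
    by (intro nn_integral_mono) (simp add: indicator_def)
  also have "\<dots> = ennreal (LINT y|lborel. ?d y)"
    by (intro nn_integral_eq_integral integrable_abs Bochner_Integration.integrable_diff integrable_kappa) simp
  also have "\<dots> \<le> ennreal (2 * phi 0 * (2 * r) ^ (CARD('n) - 1) * (b - a))"
    using kappa_shift_L1[where h = "b - a" and p = "pt k x a" and k = k] assms by (intro ennreal_leI) simp
  finally show ?thesis .
qed

text \<open>Dividing the change of potential along the segment of \<open>x\<close> by the length of
  that segment as well makes the expression antisymmetric in \<open>x\<close> and
  \<open>z\<close>.\<close>

definition P :: "real ^ 'n \<Rightarrow> real ^ 'n \<Rightarrow> real" where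
  "P x z = indicator C x * (Q x (hi x) z - Q x (lo x) z) / (hi x - lo x)"

lemma P_measurable [measurable (raw)]:
  fixes f g :: "'a \<Rightarrow> real ^ 'n"
  assumes [measurable]: "f \<in> borel_measurable M" "g \<in> borel_measurable M"
  shows "(\<lambda>x. P (f x) (g x)) \<in> borel_measurable M"
  unfolding P_def by measurable

lemma P_eq:
  "P x z = indicator C x * indicator C z * (F (hdist k x z) (lo z) (hi z) (hi x) - F (hdist k x z) (lo z) (hi z) (lo x))
    / ((hi x - lo x) * (hi z - lo z))"
  by (simp add: P_def Q_def indicator_def diff_divide_distrib mult.commute)

lemma P_antisym: "P z x = - P x z"
proof -
  have "F (hdist k x z) (lo x) (hi x) (hi z) - F (hdist k x z) (lo x) (hi x) (lo z) =
      - (F (hdist k x z) (lo z) (hi z) (hi x) - F (hdist k x z) (lo z) (hi z) (lo x))"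
    using F_swap[of "hdist k x z" "lo z" "hi z" "hi x" "lo x"] by linarith
  then show ?thesis
    unfolding P_eq[of z x] P_eq[of x z] hdist_commute[of k z x]
    by (simp only: mult_minus_right minus_divide_left mult.commute)
qed

text \<open>The divisor \<open>hi x - lo x\<close> may be arbitrarily small, but
  \<open>Q_lipschitz_L1\<close> bounds the integral of the numerator by a constant times it, and
  \<open>C\<close> has finite measure.\<close>

lemma integrable_P: "integrable (lborel \<Otimes>\<^sub>M lborel) (\<lambda>(x, z). P x z)"
proof (rule integrableI_bounded)
  show [measurable]: "(\<lambda>(x, z). P x z) \<in> borel_measurable (lborel \<Otimes>\<^sub>M lborel)" by measurable
  let ?L = "2 * phi 0 * (2 * r) ^ (CARD('n) - 1)"
  have L: "0 \<le> ?L" using phi_nonneg[of 0] r_pos by simp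
  have "(\<integral>\<^sup>+p. ennreal (norm (case p of (x, z) \<Rightarrow> P x z)) \<partial>(lborel \<Otimes>\<^sub>M lborel)) =
      (\<integral>\<^sup>+x. (\<integral>\<^sup>+z. ennreal \<bar>P x z\<bar> \<partial>lborel) \<partial>lborel)"
    by (subst lborel.nn_integral_fst[symmetric]) simp_all
  also have "\<dots> \<le> (\<integral>\<^sup>+x. ennreal ?L * indicator C x \<partial>lborel)"
  proof (rule nn_integral_mono)
    fix x
    show "(\<integral>\<^sup>+z. ennreal \<bar>P x z\<bar> \<partial>lborel) \<le> ennreal ?L * indicator C x"
    proof (cases "x \<in> C \<and> lo x < hi x")
      case True
      then have len: "0 < hi x - lo x" by simp
      have "(\<integral>\<^sup>+z. ennreal \<bar>P x z\<bar> \<partial>lborel) = (\<integral>\<^sup>+z. ennreal \<bar>Q x (hi x) z - Q x (lo x) z\<bar> / ennreal (hi x - lo x) \<partial>lborel)"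
        using True len by (intro nn_integral_cong) (simp add: P_def divide_ennreal)
      also have "\<dots> = (\<integral>\<^sup>+z. ennreal \<bar>Q x (hi x) z - Q x (lo x) z\<bar> \<partial>lborel) / ennreal (hi x - lo x)"
        by (simp add: nn_integral_divide)
      also have "\<dots> \<le> ennreal (?L * (hi x - lo x)) / ennreal (hi x - lo x)"
        by (intro divide_right_mono_ennreal Q_lipschitz_L1 lo_le_hi)
      also have "\<dots> = ennreal ?L" using len L by (simp add: divide_ennreal)
      finally show ?thesis using True by simp
    next
      case False
      then have "P x z = 0" for z using lo_le_hi[of x] by (auto simp: P_def)
      then show ?thesis by simp
    qed
  qed
  also have "\<dots> < \<infinity>"
    using compact_C emeasure_compact_finite[of C]
    by (simp add: nn_integral_cmult_indicator ennreal_mult_less_top)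
  finally show "(\<integral>\<^sup>+p. ennreal (norm (case p of (x, z) \<Rightarrow> P x z)) \<partial>(lborel \<Otimes>\<^sub>M lborel)) < \<infinity>" .
qed

lemma integral_P: "(LINT z|lborel. P x z) = indicator C x * (V (pt k x (hi x)) - V (pt k x (lo x))) / (hi x - lo x)"
  by (simp add: P_def V_eq integrable_Q)

definition mid :: "real ^ 'n \<Rightarrow> real" where
  "mid z = (lo z + hi z) / 2"

lemma mid_measurable [measurable]: "mid \<in> borel_measurable borel"
  unfolding mid_def by measurable

lemma mid_bounded: "\<exists>R. \<forall>z\<in>C. \<bar>mid z\<bar> \<le> R"
proof -
  obtain R where R: "\<And>z t. fib z t \<Longrightarrow> \<bar>t\<bar> \<le> R" using ex_bound by blast
  have "\<bar>mid z\<bar> \<le> R" if "z \<in> C" for z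
    using R[of z "lo z"] R[of z "hi z"] fib_iff[OF that] lo_le_hi[of z] by (auto simp: mid_def abs_le_iff)
  then show ?thesis by blast
qed

text \<open>The ends of the segment of \<open>x\<close> lie symmetrically about
  \<open>mid x\<close>, so the end on the side of \<open>mid z\<close> is at least as near to
  \<open>mid z\<close> as the other one.\<close>

lemma P_mid_nonneg: "0 \<le> (mid z - mid x) * P x z"
proof -
  let ?F = "F (hdist k x z) (lo z) (hi z)"
  have *: "0 \<le> (mid z - mid x) * (?F (hi x) - ?F (lo x))"
  proof (cases "mid x \<le> mid z")
    case True
    then have "?F (lo x) \<le> ?F (hi x)"
      using lo_le_hi[of x] by (intro F_antimono lo_le_hi) (auto simp: mid_def abs_if field_simps)
    then show ?thesis using True by simp
  next
    case False
    then have "?F (hi x) \<le> ?F (lo x)"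
      using lo_le_hi[of x] by (intro F_antimono lo_le_hi) (auto simp: mid_def abs_if field_simps)
    then show ?thesis using False by (intro mult_nonpos_nonpos) auto
  qed
  have "0 \<le> indicator C x * indicator C z * ((mid z - mid x) * (?F (hi x) - ?F (lo x))) / ((hi x - lo x) * (hi z - lo z))"
    by (intro divide_nonneg_nonneg mult_nonneg_nonneg *) (simp_all add: lo_le_hi)
  then show ?thesis by (simp add: P_eq mult_ac)
qed

text \<open>Since \<open>P\<close> is antisymmetric, the double integral of \<open>(mid z - mid x) P x z\<close> is twice that
  of \<open>(M - mid x) P x z\<close> for every \<open>M\<close>; for large \<open>M\<close> the inner integral of the latter over
  \<open>z\<close> is a nonpositive multiple of \<open>V\<close> at the top minus \<open>V\<close> at the bottom of the fibre.\<close>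

lemma AE_F_ends_eq:
  assumes V_le: "\<And>x. x \<in> C \<Longrightarrow> V (pt k x (hi x)) \<le> V (pt k x (lo x))"
  shows "AE x in lborel. AE z in lborel. x \<in> C \<longrightarrow> z \<in> C \<longrightarrow>
    F (hdist k x z) (lo z) (hi z) (hi x) = F (hdist k x z) (lo z) (hi z) (lo x)"
proof -
  obtain M where M: "\<And>z. z \<in> C \<Longrightarrow> \<bar>mid z\<bar> \<le> M" using mid_bounded by blast
  define U where "U x z = (M - mid x) * P x z" for x z
  have [measurable]: "(\<lambda>(x, z). U x z) \<in> borel_measurable (lborel \<Otimes>\<^sub>M lborel)" unfolding U_def by measurable
  have int_U: "integrable (lborel \<Otimes>\<^sub>M lborel) (\<lambda>(x, z). U x z)"
  proof (rule Bochner_Integration.integrable_bound)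
    show "integrable (lborel \<Otimes>\<^sub>M lborel) (\<lambda>p. 2 * M * (case p of (x, z) \<Rightarrow> P x z))"
      by (intro integrable_mult_right integrable_P)
    have "\<bar>U x z\<bar> \<le> \<bar>2 * M * P x z\<bar>" for x z
    proof (cases "x \<in> C")
      case True
      then have "\<bar>M - mid x\<bar> \<le> \<bar>2 * M\<bar>" using M[OF True] by (auto simp: abs_if split: if_splits)
      then show ?thesis unfolding U_def abs_mult[of _ "P x z"] by (rule mult_right_mono) simp
    qed (simp add: U_def P_def)
    then show "AE p in lborel \<Otimes>\<^sub>M lborel. norm (case p of (x, z) \<Rightarrow> U x z) \<le> norm (2 * M * (case p of (x, z) \<Rightarrow> P x z))"
      by (intro AE_I2) (simp add: split_beta)
  qed simp
  have swap: "integrable (lborel \<Otimes>\<^sub>M lborel) (\<lambda>(x, z). U z x)"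
    "integral\<^sup>L (lborel \<Otimes>\<^sub>M lborel) (\<lambda>(x, z). U z x) = integral\<^sup>L (lborel \<Otimes>\<^sub>M lborel) (\<lambda>(x, z). U x z)"
    using lborel_pair.integrable_product_swap[OF int_U] lborel_pair.integral_product_swap[of "\<lambda>(x, z). U x z"]
    by simp_all
  have "(LINT z|lborel. U x z) \<le> 0" for x
  proof (cases "x \<in> C")
    case True
    have "(LINT z|lborel. P x z) \<le> 0"
      unfolding integral_P using V_le[OF True] lo_le_hi[of x] True by (simp add: divide_nonpos_nonneg)
    then show ?thesis
      using M[OF True] unfolding U_def by (auto intro: mult_nonneg_nonpos)
  qed (simp add: U_def P_def)
  then have "0 \<le> (LINT x|lborel. - (LINT z|lborel. U x z))"
    by (intro integral_nonneg_AE AE_I2) simp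
  then have U_le: "integral\<^sup>L (lborel \<Otimes>\<^sub>M lborel) (\<lambda>(x, z). U x z) \<le> 0"
    using lborel_pair.integral_fst'[OF int_U] by simp
  have sum_eq: "U x z + U z x = (mid z - mid x) * P x z" for x z
    by (simp add: U_def P_antisym[of z x] algebra_simps)
  let ?W = "\<lambda>p. case p of (x, z) \<Rightarrow> (mid z - mid x) * P x z"
  have W_eq: "?W = (\<lambda>p. (case p of (x, z) \<Rightarrow> U x z) + (case p of (x, z) \<Rightarrow> U z x))"
    by (auto simp: sum_eq)
  have int_W: "integrable (lborel \<Otimes>\<^sub>M lborel) ?W"
    unfolding W_eq by (intro Bochner_Integration.integrable_add int_U swap)
  have "integral\<^sup>L (lborel \<Otimes>\<^sub>M lborel) ?W \<le> 0"
    unfolding W_eq using U_le by (simp add: Bochner_Integration.integral_add int_U swap)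
  moreover have W_nonneg: "AE p in lborel \<Otimes>\<^sub>M lborel. 0 \<le> ?W p"
    by (intro AE_I2) (simp add: split_beta P_mid_nonneg)
  ultimately have "integral\<^sup>L (lborel \<Otimes>\<^sub>M lborel) ?W = 0"
    using integral_nonneg_AE[OF W_nonneg] by linarith
  then have "AE p in lborel \<Otimes>\<^sub>M lborel. ?W p = 0"
    using integral_nonneg_eq_0_iff_AE[OF int_W W_nonneg] by simp
  from lborel_pair.AE_pair[OF this]
  have "AE x in lborel. AE z in lborel. (mid z - mid x) * P x z = 0" by simp
  with nondegenerate show ?thesis
  proof eventually_elim
    case (elim x)
    note x = elim(1)
    from elim(2) nondegenerate show ?case
    proof eventually_elim
      case (elim z)
      show ?case
      proof (intro impI)
        assume C: "x \<in> C" "z \<in> C"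
        show "F (hdist k x z) (lo z) (hi z) (hi x) = F (hdist k x z) (lo z) (hi z) (lo x)"
        \<comment> \<open>With equal midpoints the vanishing product says nothing about
          \<open>P\<close>, but then both ends of the segment of \<open>x\<close> are equally far
          from the midpoint of the segment of \<open>z\<close>.\<close>
        proof (cases "mid x = mid z")
          case True
          then show ?thesis
            using lo_le_hi[of x] by (intro F_cong_dist lo_le_hi) (simp add: mid_def abs_if field_simps)
        next
          case False
          then show ?thesis using elim x C by (simp add: P_eq)
        qed
      qed
    qed
  qed
qed

end

section \<open>The support of the distribution of segments\<close>

context fibers
begin

lemma open_subset_lo_hi:
  assumes "open U" "U \<subseteq> C" "z \<in> U"
  shows "lo z < z $ k" "z $ k < hi z"
proof -
  have "open ((\<lambda>t. pt k z t) -` U)"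
    by (intro open_vimage assms(1) continuous_intros)
  then obtain \<delta> where \<delta>: "\<delta> > 0" "\<And>t. \<bar>t - z $ k\<bar> < \<delta> \<Longrightarrow> pt k z t \<in> U"
    unfolding open_dist using assms(3) by (force simp: dist_real_def)
  have "fib z (z $ k - \<delta> / 2)" "fib z (z $ k + \<delta> / 2)"
    unfolding fib_def using \<delta> assms(2) by (auto simp: closed_segment_eq_real_ivl abs_if)
  moreover have "z \<in> C" using assms by blast
  ultimately show "lo z < z $ k" "z $ k < hi z"
    using fib_iff[of z] \<delta>(1) by fastforce+
qed

text \<open>The end of a segment has this same segment, so as a point of \<open>U\<close> it would
  have to lie strictly between its own ends.\<close>

lemma ends_notin_open:
  assumes "open U" "U \<subseteq> C" "z \<in> C"
  shows "pt k z (lo z) \<notin> U" "pt k z (hi z) \<notin> U"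
proof -
  have "fib z (lo z)" "fib z (hi z)" using fib_iff[OF assms(3)] lo_le_hi[of z] by auto
  then have "lo (pt k z (lo z)) = lo z" "hi (pt k z (hi z)) = hi z"
    using lo_pt hi_pt by auto
  then show "pt k z (lo z) \<notin> U" "pt k z (hi z) \<notin> U"
    using open_subset_lo_hi[OF assms(1,2), of "pt k z (lo z)"]
      open_subset_lo_hi[OF assms(1,2), of "pt k z (hi z)"] by auto
qed

definition graph :: "real ^ 'n \<Rightarrow> (real ^ 'n) \<times> real \<times> real" where
  "graph z = (z, lo z, hi z)"

text \<open>The support of the image of Lebesgue measure on \<open>C\<close> under \<open>graph\<close>. The functions \<open>lo\<close>
  and \<open>hi\<close> are only semicontinuous, but closed relations that hold almost everywhere on their
  graph hold everywhere on this support.\<close>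

definition S :: "((real ^ 'n) \<times> real \<times> real) set" where
  "S = \<Inter>{Z. closed Z \<and> (AE z in lborel. z \<in> C \<longrightarrow> graph z \<in> Z)}"

lemma S_subset: "closed Z \<Longrightarrow> (AE z in lborel. z \<in> C \<longrightarrow> graph z \<in> Z) \<Longrightarrow> S \<subseteq> Z"
  unfolding S_def by blast

lemma closed_S: "closed S"
  unfolding S_def by (rule closed_Inter) blast

text \<open>The complement of \<open>S\<close> is a union of possibly uncountably many open sets,
  each avoided by the graph almost everywhere; \<open>Lindelof\<close> leaves countably
  many.\<close>

lemma AE_graph_in_S: "AE z in lborel. z \<in> C \<longrightarrow> graph z \<in> S"
proof -
  let ?\<F> = "uminus ` {Z. closed Z \<and> (AE z in lborel. z \<in> C \<longrightarrow> graph z \<in> Z)}"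
  have "\<And>Y. Y \<in> ?\<F> \<Longrightarrow> open Y" by auto
  from Lindelof[OF this] obtain \<G> where \<G>: "\<G> \<subseteq> ?\<F>" "countable \<G>" "\<Union>\<G> = \<Union>?\<F>" by blast
  have "AE z in lborel. \<forall>Y\<in>\<G>. z \<in> C \<longrightarrow> graph z \<notin> Y"
    unfolding AE_ball_countable[OF \<G>(2)] using \<G>(1) by auto
  then show ?thesis
  proof eventually_elim
    case (elim z)
    show ?case
    proof
      assume "z \<in> C"
      then have "graph z \<notin> \<Union>?\<F>" using elim \<G>(3) by blast
      then show "graph z \<in> S" unfolding S_def by blast
    qed
  qed
qed

lemma compact_S: "compact S"
proof -
  obtain R where R: "\<And>z t. fib z t \<Longrightarrow> \<bar>t\<bar> \<le> R" using ex_bound by blast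
  have "graph z \<in> C \<times> {-R..R} \<times> {-R..R}" if "z \<in> C" for z
    using that R[of z "lo z"] R[of z "hi z"] fib_iff[OF that] lo_le_hi[of z]
    by (auto simp: graph_def abs_le_iff)
  moreover have "compact (C \<times> {-R..R} \<times> {-R..R})" by (intro compact_Times compact_C compact_Icc)
  ultimately have "S \<subseteq> C \<times> {-R..R} \<times> {-R..R}"
    by (intro S_subset compact_imp_closed AE_I2) auto
  with \<open>compact (C \<times> _)\<close> closed_S show ?thesis by (metis compact_Int_closed inf.absorb_iff2)
qed

text \<open>The projection of \<open>S\<close> is closed and contains almost every point of
  \<open>C\<close>, so what it misses of \<open>U\<close> is open and null, hence empty. The pair
  \<open>(a, b)\<close> is not claimed to be \<open>(lo x, hi x)\<close>.\<close>

lemma S_over_open: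
  assumes "open U" "U \<subseteq> C" "x \<in> U"
  shows "\<exists>a b. (x, a, b) \<in> S"
proof (rule ccontr)
  assume "\<not> ?thesis"
  then have x: "x \<notin> fst ` S" by auto
  have "closed (fst ` S)"
    by (intro compact_imp_closed compact_continuous_image continuous_intros compact_S)
  then have U: "open (U - fst ` S)" using assms(1) by (rule open_Diff[rotated])
  have "AE z in lborel. z \<notin> U - fst ` S"
    using AE_graph_in_S
  proof eventually_elim
    case (elim z)
    then show ?case using assms(2) by (force simp: graph_def)
  qed
  then have "U - fst ` S \<in> null_sets lborel"
    using U by (subst AE_iff_null_sets) auto
  then have "negligible (U - fst ` S)"
    unfolding negligible_iff_null_sets by (rule null_sets_completionI)
  then show False using open_not_negligible[OF U] x assms(3) by blast
qed

end

context profile_fibers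
begin

text \<open>The almost everywhere identity passes to \<open>S\<close> in two rounds: in
  \<open>z\<close> for almost every fixed \<open>x\<close>, then in \<open>x\<close>, as an
  intersection of closed conditions is closed.\<close>

lemma S_F_ends_eq:
  assumes V_le: "\<And>x. x \<in> C \<Longrightarrow> V (pt k x (hi x)) \<le> V (pt k x (lo x))"
    and "(x, a, b) \<in> S" "(z, c, d) \<in> S"
  shows "F (hdist k x z) c d b = F (hdist k x z) c d a"
proof -
  define Z where "Z e = {s. F (hdist k (fst e) (fst s)) (fst (snd s)) (snd (snd s)) (snd (snd e)) =
      F (hdist k (fst e) (fst s)) (fst (snd s)) (snd (snd s)) (fst (snd e))}"
    for e :: "(real ^ 'n) \<times> real \<times> real"
  have cl: "closed (Z e)" for e
    unfolding Z_def by (intro closed_Collect_eq continuous_intros)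
  have "AE x in lborel. AE z in lborel. x \<in> C \<longrightarrow> z \<in> C \<longrightarrow>
      F (hdist k x z) (lo z) (hi z) (hi x) = F (hdist k x z) (lo z) (hi z) (lo x)"
    by (rule AE_F_ends_eq) (rule V_le)
  then have "AE x in lborel. x \<in> C \<longrightarrow> S \<subseteq> Z (graph x)"
  proof eventually_elim
    case (elim x)
    show ?case
    proof
      assume "x \<in> C"
      show "S \<subseteq> Z (graph x)"
        by (rule S_subset[OF cl]) (use elim \<open>x \<in> C\<close> in \<open>auto simp: Z_def graph_def\<close>)
    qed
  qed
  moreover have "closed (\<Inter>s\<in>S. {e. s \<in> Z e})"
    unfolding Z_def mem_Collect_eq by (intro closed_INT ballI closed_Collect_eq continuous_intros)
  ultimately have "S \<subseteq> (\<Inter>s\<in>S. {e. s \<in> Z e})"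
    by (intro S_subset) (auto elim!: eventually_mono)
  then have "(z, c, d) \<in> Z (x, a, b)" using assms(2,3) by blast
  then show ?thesis by (simp add: Z_def)
qed

end

text \<open>\<open>V_antimono\<close> is condition (1) expressed through the potential of the
  closure, which enters the curvature with a negative sign; \<open>sphere_meets\<close> is what
  condition (4) supplies for the indicator.\<close>

locale nonlocal_domain = profile_fibers phi r "closure \<Omega>" k
  for phi :: "real \<Rightarrow> real" and r :: real and \<Omega> :: "(real ^ 'n) set" and k :: 'n +
  assumes open_\<Omega>: "open \<Omega>"
    and connected_\<Omega>: "connected \<Omega>"
    and V_antimono: "\<And>x a b. a < b \<Longrightarrow> pt k x a \<in> frontier \<Omega> \<Longrightarrow> pt k x b \<in> frontier \<Omega> \<Longrightarrow>
      (\<And>s. a \<le> s \<Longrightarrow> s \<le> b \<Longrightarrow> pt k x s \<in> closure \<Omega>) \<Longrightarrow> V (pt k x b) \<le> V (pt k x a)"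
    and sphere_meets: "\<And>p. \<not> strict \<Longrightarrow> p \<in> frontier \<Omega> \<Longrightarrow> \<exists>z\<in>\<Omega>. dist p z = r"
begin

lemma frontier_eq: "frontier \<Omega> = closure \<Omega> - \<Omega>"
  by (simp add: frontier_def interior_open open_\<Omega>)

lemma ends_in_frontier:
  assumes "z \<in> closure \<Omega>"
  shows "pt k z (lo z) \<in> frontier \<Omega>" "pt k z (hi z) \<in> frontier \<Omega>"
  using ends_notin_open[OF open_\<Omega> closure_subset assms] pt_in_C[OF assms] lo_le_hi[of z]
  by (auto simp: frontier_eq)

lemma V_ends: "x \<in> closure \<Omega> \<Longrightarrow> V (pt k x (hi x)) \<le> V (pt k x (lo x))"
  using V_antimono[of "lo x" "hi x" x] ends_in_frontier[of x] pt_in_C[of x] lo_le_hi[of x]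
  by (cases "lo x = hi x") auto

lemma S_ends_eq:
  "(x, a, b) \<in> S \<Longrightarrow> (z, c, d) \<in> S \<Longrightarrow> F (hdist k x z) c d b = F (hdist k x z) c d a"
  using S_F_ends_eq V_ends by blast

text \<open>These relations are closed, so they survive limits of graph points. Maximality of the
  segment is not of this kind and is therefore not among them.\<close>

lemma S_fiber:
  assumes "(x, a, b) \<in> S"
  shows "a \<le> x $ k" "x $ k \<le> b" "pt k x a \<in> frontier \<Omega>" "pt k x b \<in> frontier \<Omega>"
    "\<And>s. a \<le> s \<Longrightarrow> s \<le> b \<Longrightarrow> pt k x s \<in> closure \<Omega>"
proof -
  define Z where "Z = {e. fst (snd e) \<le> fst e $ k} \<inter> {e. fst e $ k \<le> snd (snd e)} \<inter>
    (\<lambda>e. pt k (fst e) (fst (snd e))) -` frontier \<Omega> \<inter> (\<lambda>e. pt k (fst e) (snd (snd e))) -` frontier \<Omega> \<inter>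
    (\<Inter>\<theta>\<in>{0..1}. (\<lambda>e. pt k (fst e) ((1 - \<theta>) * fst (snd e) + \<theta> * snd (snd e))) -` closure \<Omega>)"
  have "closed Z"
    unfolding Z_def
    by (intro closed_Int closed_INT ballI closed_Collect_le closed_vimage continuous_intros) auto
  moreover have "graph z \<in> Z" if "z \<in> closure \<Omega>" for z
  proof -
    have "(1 - \<theta>) * lo z + \<theta> * hi z \<in> {lo z..hi z}" if "\<theta> \<in> {0..1}" for \<theta>
    proof -
      have "0 \<le> \<theta> * (hi z - lo z)" "\<theta> * (hi z - lo z) \<le> hi z - lo z"
        using that lo_le_hi[of z] by (auto intro: mult_left_le_one_le)
      then show ?thesis by (simp add: algebra_simps)
    qed
    then show ?thesis
      using ends_in_frontier[OF that] lo_le[OF that] le_hi[OF that] pt_in_C[OF that]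
      by (auto simp: Z_def graph_def)
  qed
  ultimately have "S \<subseteq> Z" by (intro S_subset AE_I2) auto
  then have Z: "(x, a, b) \<in> Z" using assms by blast
  then show 1: "a \<le> x $ k" "x $ k \<le> b" "pt k x a \<in> frontier \<Omega>" "pt k x b \<in> frontier \<Omega>"
    by (auto simp: Z_def)
  fix s assume "a \<le> s" "s \<le> b"
  then have "s \<in> (\<lambda>\<theta>. (1 - \<theta>) *\<^sub>R a + \<theta> *\<^sub>R b) ` {0..1}"
    unfolding closed_segment_image_interval[symmetric] by (auto simp: closed_segment_eq_real_ivl)
  then show "pt k x s \<in> closure \<Omega>" using Z by (auto simp: Z_def)
qed

text \<open>The height \<open>t\<close> cuts the segment into two with ends on the frontier, so
  \<open>V\<close> at \<open>t\<close> lies between its values at \<open>b\<close> and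
  \<open>a\<close>, which agree by \<open>S_ends_eq\<close>. On the other hand almost every single
  segment has at \<open>t\<close> at least its common potential at \<open>a\<close> and
  \<open>b\<close>, because \<open>t\<close> is no farther from its midpoint than one of these.
  Equal integrals then force equality almost everywhere, hence on \<open>S\<close>.\<close>

lemma S_frontier_inside:
  assumes e: "(x, a, b) \<in> S" and t: "a < t" "t < b" "pt k x t \<in> frontier \<Omega>" and s: "(z, c, d) \<in> S"
  shows "F (hdist k x z) c d t = F (hdist k x z) c d a"
proof -
  note f = S_fiber[OF e]
  have le: "V (pt k x t) \<le> V (pt k x a)" "V (pt k x b) \<le> V (pt k x t)"
    using V_antimono[of a t x] V_antimono[of t b x] f t by auto
  have eq: "AE z in lborel. Q x b z = Q x a z"
    using AE_graph_in_S by eventually_elim (auto simp: Q_def graph_def indicator_def S_ends_eq[OF e])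
  then have "V (pt k x b) = V (pt k x a)"
    unfolding V_eq by (intro integral_cong_AE) auto
  with le have 0: "(LINT z|lborel. Q x t z - Q x a z) = 0"
    by (simp add: V_eq integrable_Q)
  have "AE z in lborel. 0 \<le> Q x t z - Q x a z"
    using AE_graph_in_S
  proof eventually_elim
    case (elim z)
    show ?case
    proof (cases "z \<in> closure \<Omega>")
      case True
      let ?F = "F (hdist k x z) (lo z) (hi z)" and ?m = "(lo z + hi z) / 2"
      have "?F b = ?F a" using True elim S_ends_eq[OF e] by (simp add: graph_def)
      moreover have "\<bar>t - m\<bar> \<le> \<bar>a - m\<bar> \<or> \<bar>t - m\<bar> \<le> \<bar>b - m\<bar>" for m using t by arith
      ultimately have "?F a \<le> ?F t" using F_antimono[OF lo_le_hi[of z]] by metis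
      then show ?thesis
        using lo_le_hi[of z] by (simp add: Q_def indicator_def divide_right_mono)
    qed (simp add: Q_def)
  qed
  then have "AE z in lborel. Q x t z - Q x a z = 0"
    using 0 by (subst (asm) integral_nonneg_eq_0_iff_AE) (auto intro: integrable_Q)
  with nondegenerate have "AE z in lborel. z \<in> closure \<Omega> \<longrightarrow>
      graph z \<in> {s. F (hdist k x (fst s)) (fst (snd s)) (snd (snd s)) t = F (hdist k x (fst s)) (fst (snd s)) (snd (snd s)) a}"
    by eventually_elim (auto simp: Q_def graph_def)
  then have "S \<subseteq> {s. F (hdist k x (fst s)) (fst (snd s)) (snd (snd s)) t = F (hdist k x (fst s)) (fst (snd s)) (snd (snd s)) a}"
    by (intro S_subset closed_Collect_eq continuous_intros)
  then show ?thesis using s by fastforce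
qed

end

section \<open>Reflection symmetry\<close>

context radial_profile
begin

lemma K_eq_0_outside: "r\<^sup>2 \<le> u\<^sup>2 + t\<^sup>2 \<Longrightarrow> K u t = 0"
  unfolding K_def using r_pos by (intro phi_eq_0 real_le_rsqrt)

lemma K_pos_inside: "u\<^sup>2 + t\<^sup>2 < r\<^sup>2 \<Longrightarrow> 0 < K u t"
  unfolding K_def using r_pos by (intro phi_pos real_less_lsqrt) auto

lemma F_eq_0_outside:
  assumes "c \<le> d" "t \<le> c" "r\<^sup>2 \<le> u\<^sup>2 + (c - t)\<^sup>2"
  shows "F u c d t = 0"
proof -
  have "(\<lambda>s. indicator {c..d} s * K u (t - s)) = (\<lambda>s. 0)"
  proof
    fix s show "indicator {c..d} s * K u (t - s) = 0"
    proof (cases "c \<le> s")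
      case True
      then have "(c - t)\<^sup>2 \<le> (t - s)\<^sup>2" using assms(2) by (subst abs_le_square_iff[symmetric]) simp
      then have "K u (t - s) = 0" using assms(3) by (intro K_eq_0_outside) linarith
      then show ?thesis by simp
    qed simp
  qed
  then show ?thesis by (simp add: F_eq_integral(1)[OF assms(1)])
qed

text \<open>\<open>w\<close> is half the chord that a ball of radius \<open>r\<close> cuts out of a
  vertical line at horizontal distance \<open>u\<close> from its centre. The segment starts at
  \<open>c\<close>, so a ball at height \<open>c + w\<close> still reaches points just above
  \<open>c\<close>, while one at height \<open>c - w\<close> does not.\<close>

lemma F_pos:
  assumes "c < d" "0 \<le> w" "r\<^sup>2 = u\<^sup>2 + w\<^sup>2" "c - w < t" "t \<le> c + w"
  shows "0 < F u c d t"
proof -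
  have "0 < (LINT s|lborel. indicator {c..d} s * K u (t - s))"
  proof (rule integral_pos_if_pos_on_interval[of _ c "min d (t + w)"])
    show "integrable lborel (\<lambda>s. indicator {c..d} s * K u (t - s))"
      by (rule F_eq_integral(2)) (use assms in simp)
    fix s assume s: "c < s" "s < min d (t + w)"
    then have "\<bar>t - s\<bar> < w" using assms by (simp add: abs_if)
    then have "(t - s)\<^sup>2 < w\<^sup>2" using assms(2) abs_le_square_iff[of w "t - s"] by simp
    then show "0 < indicator {c..d} s * K u (t - s)"
      using s assms(3) by (simp add: K_pos_inside)
  qed (use assms in \<open>auto simp: K_nonneg\<close>)
  then show ?thesis using assms(1) by (simp add: F_eq_integral)
qed

end

section \<open>Segments seen by other segments\<close>

context nonlocal_domain
begin

lemma S_strict: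
  assumes "(x, a, b) \<in> S" "x \<in> \<Omega>"
  shows "a < x $ k" "x $ k < b"
proof -
  have "a \<noteq> x $ k" "b \<noteq> x $ k"
    using S_fiber(3,4)[OF assms(1)] assms(2) by (auto simp: frontier_eq)
  then show "a < x $ k" "x $ k < b" using S_fiber(1,2)[OF assms(1)] by auto
qed

text \<open>Both segments contain \<open>x\<close> strictly inside. If their lower ends differ, the
  higher one is a frontier point strictly inside the other segment, and
  \<open>S_frontier_inside\<close> applies.\<close>

lemma S_same_base:
  assumes e: "(x, a, b) \<in> S" "(x, a', b') \<in> S" "x \<in> \<Omega>" and s: "(z, c, d) \<in> S"
  shows "F (hdist k x z) c d a' = F (hdist k x z) c d a"
  using S_frontier_inside[OF e(1) _ _ S_fiber(3)[OF e(2)] s]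
    S_frontier_inside[OF e(2) _ _ S_fiber(3)[OF e(1)] s]
    S_strict[OF e(1,3)] S_strict[OF e(2,3)]
  by (cases a a' rule: linorder_cases) auto

text \<open>The lower end of \<open>e\<close> suffices, because for elements of \<open>S\<close> the
  potential of \<open>s\<close> agrees at both ends of \<open>e\<close>. For fixed \<open>s\<close>
  the condition is open in \<open>e\<close>.\<close>

definition sees :: "(real ^ 'n) \<times> real \<times> real \<Rightarrow> (real ^ 'n) \<times> real \<times> real \<Rightarrow> bool" where
  "sees s e \<longleftrightarrow> fst (snd s) < snd (snd s) \<and>
     band (dist (pt k (fst e) (fst (snd e))) (pt k (fst s) (fst (snd s))))
          (dist (pt k (fst e) (fst (snd e))) (pt k (fst s) (snd (snd s))))"

lemma open_sees: "open {e. sees s e}"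
  unfolding sees_def by (intro open_Collect_conj open_Collect_const open_band continuous_intros)

lemma sees_rigid:
  assumes "sees (z, c, d) (x, a, b)" "F (hdist k x z) c d t = F (hdist k x z) c d a"
  shows "\<bar>t - (c + d) / 2\<bar> = \<bar>a - (c + d) / 2\<bar>"
  using assms F_rigid[of c d "hdist k x z" a t] by (simp add: sees_def dist_pt)

lemma sees_mid:
  assumes "sees (z, c, d) (x, a, b)" "(z, c, d) \<in> S" "(x, a, b) \<in> S" "x \<in> \<Omega>"
  shows "a + b = c + d"
  using sees_rigid[OF assms(1) S_ends_eq[OF assms(3,2)]] S_strict[OF assms(3,4)]
  by (auto simp: abs_if field_simps split: if_splits)

text \<open>All ends of elements of \<open>S\<close> over \<open>x\<close> have the same potential
  with respect to the seeing segment, hence the same distance from its midpoint. This identifies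
  limits in \<open>mid_const\<close>.\<close>

lemma sees_unique:
  assumes "sees (z, c, d) (x, a, b)" "(z, c, d) \<in> S" "(x, a, b) \<in> S" "(x, a', b') \<in> S" "x \<in> \<Omega>"
  shows "a' = a" "b' = b"
proof -
  let ?m = "(c + d) / 2"
  have "F (hdist k x z) c d a' = F (hdist k x z) c d a"
    using S_same_base assms by blast
  moreover have "F (hdist k x z) c d b' = F (hdist k x z) c d a'"
    using S_ends_eq assms by blast
  ultimately have "\<bar>a' - ?m\<bar> = \<bar>a - ?m\<bar>" "\<bar>b' - ?m\<bar> = \<bar>a - ?m\<bar>"
    using sees_rigid[OF assms(1)] by metis+
  moreover have "a + b = 2 * ?m" using sees_mid[OF assms(1-3,5)] by simp
  moreover have "a < b" "a' < b'"
    using S_strict[OF assms(3,5)] S_strict[OF assms(4,5)] by auto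
  ultimately show "a' = a" "b' = b" by (auto simp only: abs_if split: if_splits)
qed

lemma sees_inside:
  assumes "sees (z, c, d) (x, a, b)" "(z, c, d) \<in> S" "(x, a, b) \<in> S" "x \<in> \<Omega>" "a < t" "t < b"
  shows "pt k x t \<in> \<Omega>"
proof (rule ccontr)
  assume "pt k x t \<notin> \<Omega>"
  then have "pt k x t \<in> frontier \<Omega>"
    using S_fiber(5)[OF assms(3), of t] assms(5,6) by (simp add: frontier_eq)
  then have "\<bar>t - (c + d) / 2\<bar> = \<bar>a - (c + d) / 2\<bar>"
    by (intro sees_rigid[OF assms(1)] S_frontier_inside[OF assms(3) assms(5,6)] assms)
  then show False
    using sees_mid[OF assms(1-4)] assms(5,6) by (auto simp: abs_if field_simps split: if_splits)
qed

text \<open>Only the case of an indicator profile needs an argument. An unseen segment would split the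
  connected set \<open>\<Omega>\<close> into the points whose segments end inside the ball about its lower end and
  those whose segments end outside. Over a point of both kinds the segment ending outside puts
  its lower end out of reach of the unseen segment, and then both ends of the one ending inside
  have to be out of reach as well.\<close>

lemma ex_sees:
  assumes e: "(x, a, b) \<in> S" and x: "x \<in> \<Omega>"
  shows "\<exists>s\<in>S. sees s (x, a, b)"
proof (cases strict)
  case True
  \<comment> \<open>The lower end has distance 0 from itself, so for a strictly decreasing profile
    the segment sees itself.\<close>
  then have "sees (x, a, b) (x, a, b)"
    using S_strict[OF e x] r_pos by (simp add: sees_def band_def)
  then show ?thesis using e by blast
next
  case False
  show ?thesis
  proof (rule ccontr)
    assume unseen: "\<not> ?thesis"
    define p where "p = pt k x a"
    define f where "f s = dist p (pt k (fst s) (fst (snd s)))" for s :: "(real ^ 'n) \<times> real \<times> real"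
    define g where "g s = dist p (pt k (fst s) (snd (snd s)))" for s :: "(real ^ 'n) \<times> real \<times> real"
    have cont: "continuous_on UNIV f" "continuous_on UNIV g"
      unfolding f_def g_def by (intro continuous_intros)+
    have dich: "max (f s) (g s) \<le> r \<or> r \<le> min (f s) (g s)" if "s \<in> S" "fst s \<in> \<Omega>" for s
    proof -
      obtain z c d where s: "s = (z, c, d)" by (cases s)
      then have "c < d" using S_strict[of z c d] that by auto
      moreover have "\<not> sees s (x, a, b)" using unseen that by blast
      ultimately show ?thesis using False by (auto simp: s sees_def band_def f_def g_def p_def)
    qed
    let ?A = "fst ` (S \<inter> {s. max (f s) (g s) \<le> r})" and ?B = "fst ` (S \<inter> {s. r \<le> min (f s) (g s)})"
    have cl: "closed ?A" "closed ?B"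
      by (intro compact_imp_closed compact_continuous_image continuous_intros compact_Int_closed
          compact_S closed_Collect_le continuous_on_max continuous_on_min cont)+
    have cover: "\<Omega> \<subseteq> ?A \<union> ?B"
    proof
      fix z assume z: "z \<in> \<Omega>"
      then obtain c d where "(z, c, d) \<in> S" using S_over_open[OF open_\<Omega> closure_subset] by blast
      then show "z \<in> ?A \<union> ?B" using dich[of "(z, c, d)"] z by force
    qed
    have "f (x, a, b) = 0" by (simp add: f_def p_def)
    then have "(x, a, b) \<in> {s. max (f s) (g s) \<le> r}"
      using dich[OF e] x r_pos by auto
    then have A: "?A \<inter> \<Omega> \<noteq> {}" using e x by force
    obtain z0 where z0: "z0 \<in> \<Omega>" "dist p z0 = r"
      using sphere_meets[OF False] S_fiber(3)[OF e] p_def by blast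
    obtain c0 d0 where s0: "(z0, c0, d0) \<in> S"
      using S_over_open[OF open_\<Omega> closure_subset z0(1)] by blast
    \<comment> \<open>\<open>z0\<close> has distance \<open>r\<close> from \<open>p\<close> and lies
      strictly between the ends, so it cannot be at least as far from \<open>p\<close> as both of
      them.\<close>
    have "\<not> max (f (z0, c0, d0)) (g (z0, c0, d0)) \<le> r"
    proof
      assume le: "max (f (z0, c0, d0)) (g (z0, c0, d0)) \<le> r"
      let ?u = "hdist k x z0"
      have "sqrt (?u\<^sup>2 + (a - c0)\<^sup>2) \<le> sqrt (?u\<^sup>2 + (a - z0 $ k)\<^sup>2)"
        "sqrt (?u\<^sup>2 + (a - d0)\<^sup>2) \<le> sqrt (?u\<^sup>2 + (a - z0 $ k)\<^sup>2)"
        using le z0(2) dist_pt[of k x a z0 "z0 $ k"] by (simp_all add: f_def g_def p_def dist_pt)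
      then have "\<bar>a - c0\<bar> \<le> \<bar>a - z0 $ k\<bar>" "\<bar>a - d0\<bar> \<le> \<bar>a - z0 $ k\<bar>"
        by (simp_all add: abs_le_square_iff)
      then show False using S_strict[OF s0 z0(1)] by arith
    qed
    then have B: "?B \<inter> \<Omega> \<noteq> {}" using dich[OF s0] s0 z0(1) by force
    have "?A \<inter> ?B \<inter> \<Omega> \<noteq> {}"
      using connected_\<Omega>[unfolded connected_closed] cl cover A B by blast
    then obtain z c d c' d' where z: "z \<in> \<Omega>" and s: "(z, c, d) \<in> S" "(z, c', d') \<in> S"
      and inside: "max (f (z, c, d)) (g (z, c, d)) \<le> r" and outside: "r \<le> min (f (z, c', d')) (g (z, c', d'))"
      by force
    define u where "u = hdist k x z"
    have "sqrt (u\<^sup>2 + (a - c)\<^sup>2) \<le> r" "sqrt (u\<^sup>2 + (a - d)\<^sup>2) \<le> r" "r \<le> sqrt (u\<^sup>2 + (a - c')\<^sup>2)"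
      using inside outside by (simp_all add: f_def g_def p_def dist_pt u_def)
    then have sq: "u\<^sup>2 + (a - c)\<^sup>2 \<le> r\<^sup>2" "u\<^sup>2 + (a - d)\<^sup>2 \<le> r\<^sup>2" "r\<^sup>2 \<le> u\<^sup>2 + (a - c')\<^sup>2"
      using r_pos by (auto simp: sqrt_le_D intro: sqrt_ge_absD)
    define w where "w = sqrt (r\<^sup>2 - u\<^sup>2)"
    have w: "0 \<le> w" "r\<^sup>2 = u\<^sup>2 + w\<^sup>2"
    proof -
      have "u\<^sup>2 \<le> r\<^sup>2" using sq(1) zero_le_power2[of "a - c"] by linarith
      then show "0 \<le> w" "r\<^sup>2 = u\<^sup>2 + w\<^sup>2" by (simp_all add: w_def)
    qed
    then have abs: "\<bar>a - c\<bar> \<le> w" "\<bar>a - d\<bar> \<le> w" "w \<le> \<bar>a - c'\<bar>"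
      using sq abs_le_square_iff[of "a - c" w] abs_le_square_iff[of "a - d" w] abs_le_square_iff[of w "a - c'"] by auto
    have order: "c < d" "c' < d" "a < b"
      using S_strict[OF s(1) z] S_strict[OF s(2) z] S_strict[OF e x] by auto
    \<comment> \<open>Otherwise \<open>c'\<close> would lie at least \<open>w\<close> above
      \<open>a\<close>, and \<open>d\<close>, being above \<open>c'\<close>, more than
      \<open>w\<close>.\<close>
    have "c' \<le> a" using abs order by arith
    then have "F u a b c' = 0"
      using order sq(3) by (intro F_eq_0_outside) auto
    moreover have "F u a b d = F u a b c" "F u a b c' = F u a b c"
      using S_ends_eq[OF s(1) e] S_same_base[OF s z e] by (simp_all add: u_def hdist_commute)
    \<comment> \<open>\<open>d\<close> is strictly above \<open>c\<close>, hence strictly above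
      \<open>a - w\<close>, and it is at most \<open>a + w\<close>.\<close>
    moreover have "0 < F u a b d"
      using w order abs by (intro F_pos[of a b w]) auto
    ultimately show False by simp
  qed
qed

text \<open>The base points of elements with sum \<open>a0 + b0\<close> and those of limits of
  elements with other sums form closed sets covering \<open>\<Omega>\<close>, so both kinds occur
  over one point. A segment that sees the first element forces the limit to coincide with it; as
  seeing is open, it also sees an element with another sum, against \<open>sees_mid\<close>.\<close>

lemma mid_const:
  assumes e0: "(x0, a0, b0) \<in> S" "x0 \<in> \<Omega>" and e: "(x, a, b) \<in> S" "x \<in> \<Omega>"
  shows "a + b = a0 + b0"
proof (rule ccontr)
  assume ne: "a + b \<noteq> a0 + b0"
  let ?h = "\<lambda>e :: (real ^ 'n) \<times> real \<times> real. fst (snd e) + snd (snd e)"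
  define T where "T = {e \<in> S. fst e \<in> \<Omega> \<and> ?h e \<noteq> a0 + b0}"
  let ?A = "fst ` (S \<inter> {e. ?h e = a0 + b0})" and ?B = "fst ` closure T"
  have T: "closure T \<subseteq> S" by (rule closure_minimal) (auto simp: T_def closed_S)
  have T_closure: "e \<in> T \<Longrightarrow> e \<in> closure T" for e using closure_subset by blast
  have "S \<inter> closure T = closure T" using T by blast
  then have T': "compact (closure T)"
    using compact_Int_closed[OF compact_S closed_closure[of T]] by (simp only:)
  have cl: "closed ?A" "closed ?B"
    by (intro compact_imp_closed compact_continuous_image continuous_intros compact_Int_closed
        compact_S closed_Collect_eq T')+
  have cover: "\<Omega> \<subseteq> ?A \<union> ?B"
  proof
    fix z assume z: "z \<in> \<Omega>"
    then obtain c d where "(z, c, d) \<in> S" using S_over_open[OF open_\<Omega> closure_subset] by blast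
    then have "(z, c, d) \<in> S \<inter> {e. ?h e = a0 + b0} \<or> (z, c, d) \<in> T"
      using z by (auto simp: T_def)
    then have "(z, c, d) \<in> S \<inter> {e. ?h e = a0 + b0} \<or> (z, c, d) \<in> closure T"
      using T_closure by blast
    then have "fst (z, c, d) \<in> ?A \<union> ?B" by blast
    then show "z \<in> ?A \<union> ?B" by simp
  qed
  have "(x0, a0, b0) \<in> S \<inter> {e. ?h e = a0 + b0}" using e0 by simp
  then have A: "?A \<inter> \<Omega> \<noteq> {}" using e0 by force
  have "(x, a, b) \<in> T" using e ne by (simp add: T_def)
  then have "(x, a, b) \<in> closure T" by (rule T_closure)
  then have "fst (x, a, b) \<in> ?B" by (rule imageI)
  then have B: "?B \<inter> \<Omega> \<noteq> {}" using e by auto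
  have "?A \<inter> ?B \<inter> \<Omega> \<noteq> {}"
    using connected_\<Omega>[unfolded connected_closed] cl cover A B by blast
  then obtain z c d c' d' where z: "z \<in> \<Omega>" "(z, c, d) \<in> S" "c + d = a0 + b0" "(z, c', d') \<in> closure T"
    by force
  obtain s where s: "s \<in> S" "sees s (z, c, d)" using ex_sees z by blast
  obtain y p q where s_eq: "s = (y, p, q)" by (cases s)
  have "(z, c', d') \<in> S" using z(4) T by blast
  then have "(z, c', d') = (z, c, d)" using sees_unique s z unfolding s_eq by blast
  then have "{e. sees s e} \<inter> closure T \<noteq> {}" using z(4) s(2) by auto
  then have "{e. sees s e} \<inter> T \<noteq> {}" using open_Int_closure_eq_empty[OF open_sees] by blast
  then obtain z1 c1 d1 where "sees s (z1, c1, d1)" "(z1, c1, d1) \<in> S" "z1 \<in> \<Omega>" "c1 + d1 \<noteq> a0 + b0"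
    by (auto simp: T_def)
  then show False using sees_mid s z unfolding s_eq by metis
qed

lemma reflection_symmetric: "\<exists>l. \<forall>x\<in>\<Omega>. pt k x (2 * l - x $ k) \<in> \<Omega>"
proof (cases "\<Omega> = {}")
  case False
  then obtain x0 where x0: "x0 \<in> \<Omega>" by blast
  obtain a0 b0 where e0: "(x0, a0, b0) \<in> S"
    using S_over_open[OF open_\<Omega> closure_subset x0] by blast
  have "pt k x (2 * ((a0 + b0) / 2) - x $ k) \<in> \<Omega>" if x: "x \<in> \<Omega>" for x
  proof -
    obtain a b where e: "(x, a, b) \<in> S" using S_over_open[OF open_\<Omega> closure_subset x] by blast
    obtain z c d where "(z, c, d) \<in> S" "sees (z, c, d) (x, a, b)" using ex_sees[OF e x] by auto
    moreover have "2 * ((a0 + b0) / 2) - x $ k = a + b - x $ k"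
      using mid_const[OF e0 x0 e x] by simp
    ultimately show ?thesis
      using S_strict[OF e x] by (simp only:) (rule sees_inside[OF _ _ e x], auto)
  qed
  then show ?thesis by blast
qed simp

end

section \<open>Hausdorff null sets and nonlocal curvature\<close>

lemma hausdorff_measure_empty: "hausdorff_measure d ({} :: 'a::metric_space set) = 0"
proof -
  have "hausdorff_content d \<delta> ({} :: 'a set) = 0" if "\<delta> > 0" for \<delta> :: real
  proof -
    let ?\<U> = "{U :: nat \<Rightarrow> 'a set. {} \<subseteq> (\<Union>i. U i) \<and> (\<forall>i. bounded (U i) \<and> diameter (U i) \<le> \<delta>)}"
    have "(\<lambda>_. {}) \<in> ?\<U>" using that by simp
    then have "hausdorff_content d \<delta> ({} :: 'a set) \<le> (\<Sum>i::nat. hausdorff_weight d ({} :: 'a set))"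
      unfolding hausdorff_content_def by (rule INF_lower)
    then show ?thesis by (simp add: hausdorff_weight_def)
  qed
  then show ?thesis by (simp add: hausdorff_measure_def)
qed

text \<open>A set lies in a ball about any of its points with its diameter as radius. The weight
  uses half the diameter, which costs a power of 2; for null sets this loss is harmless.\<close>

lemma emeasure_le_hausdorff_weight:
  fixes U :: "'a::euclidean_space set"
  assumes "bounded U"
  shows "\<exists>B\<in>sets borel. U \<subseteq> B \<and> emeasure lborel B \<le> hausdorff_weight DIM('a) U * 2 ^ DIM('a)"
proof (cases "U = {}")
  case False
  then obtain x where "x \<in> U" by blast
  let ?d = "diameter U"
  have "0 \<le> ?d" using assms by (rule diameter_ge_0)
  have "U \<subseteq> cball x ?d"
    using diameter_bounded_bound[OF assms \<open>x \<in> U\<close>] by auto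
  moreover have "emeasure lborel (cball x ?d) = ennreal (unit_ball_vol (real DIM('a)) * ?d ^ DIM('a))"
    using \<open>0 \<le> ?d\<close> by (rule emeasure_cball)
  moreover have "unit_ball_vol (real DIM('a)) * ?d ^ DIM('a) =
      unit_ball_vol (real DIM('a)) * (?d / 2) ^ DIM('a) * 2 ^ DIM('a)"
    by (simp add: power_divide)
  moreover have "ennreal (unit_ball_vol (real DIM('a)) * (?d / 2) ^ DIM('a) * 2 ^ DIM('a)) =
      hausdorff_weight DIM('a) U * 2 ^ DIM('a)"
    using False \<open>0 \<le> ?d\<close>
    by (simp add: hausdorff_weight_def ennreal_mult'' ennreal_power[symmetric])
  ultimately show ?thesis by (intro bexI[of _ "cball x ?d"]) auto
qed (auto intro: bexI[of _ "{}"])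

lemma null_sets_if_hausdorff_measure_0:
  fixes A :: "'a::euclidean_space set"
  assumes [measurable]: "A \<in> sets borel" and "hausdorff_measure DIM('a) A = 0"
  shows "A \<in> null_sets lborel"
proof -
  let ?n = "DIM('a)"
  have "emeasure lborel A / 2 ^ ?n \<le> hausdorff_content ?n 1 A"
    unfolding hausdorff_content_def
  proof (rule INF_greatest)
    fix U :: "nat \<Rightarrow> 'a set"
    assume U: "U \<in> {U. A \<subseteq> (\<Union>i. U i) \<and> (\<forall>i. bounded (U i) \<and> diameter (U i) \<le> 1)}"
    then have "\<forall>i. \<exists>B\<in>sets borel. U i \<subseteq> B \<and> emeasure lborel B \<le> hausdorff_weight ?n (U i) * 2 ^ ?n"
      using emeasure_le_hausdorff_weight by blast
    then obtain B where B: "\<And>i. B i \<in> sets borel" "\<And>i. U i \<subseteq> B i"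
      "\<And>i. emeasure lborel (B i) \<le> hausdorff_weight ?n (U i) * 2 ^ ?n" by metis
    have "emeasure lborel A \<le> emeasure lborel (\<Union>i. B i)"
      using U B(1,2) by (intro emeasure_mono) (auto, blast)
    also have "\<dots> \<le> (\<Sum>i. emeasure lborel (B i))"
      using B(1) by (intro emeasure_subadditive_countably) auto
    also have "\<dots> \<le> (\<Sum>i. hausdorff_weight ?n (U i) * 2 ^ ?n)"
      by (intro suminf_le B(3) summableI)
    also have "\<dots> = (\<Sum>i. hausdorff_weight ?n (U i)) * 2 ^ ?n"
      by (rule ennreal_suminf_multc)
    finally show "emeasure lborel A / 2 ^ ?n \<le> (\<Sum>i. hausdorff_weight ?n (U i))"
      by (intro divide_le_posI_ennreal) (simp_all add: zero_less_iff_neq_zero mult.commute)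
  qed
  also have "\<dots> \<le> hausdorff_measure ?n A"
    unfolding hausdorff_measure_def by (rule SUP_upper) simp
  finally have "emeasure lborel A = 0"
    using assms(2) by (simp add: ennreal_divide_eq_0_iff power_eq_top_ennreal)
  then show ?thesis by (simp add: null_setsI)
qed

section \<open>The curvature as a constant minus twice the potential\<close>

context radial_profile
begin

lemma integral_kappa:
  fixes p :: "real ^ 'n"
  shows "(LINT y|lborel. kappa (p - y)) = (LINT y|lborel. kappa (y :: real ^ 'n))"
proof -
  have "(LINT y|lborel. kappa (p - y)) = (LINT y|distr lborel borel ((+) p). kappa (p - y))"
    by (simp only: lborel_distr_plus)
  also have "\<dots> = (LINT y|lborel. kappa (p - (p + y)))"
    by (rule integral_distr) measurable
  finally show ?thesis by (simp add: kappa_def)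
qed

lemma nonlocal_curvature_eq:
  fixes J :: "real ^ 'n \<Rightarrow> real"
  assumes J: "\<And>z. z \<noteq> 0 \<Longrightarrow> J z = phi (norm z)"
    and \<Omega>: "open \<Omega>" "frontier \<Omega> \<in> null_sets lborel"
  shows "nonlocal_curvature J \<Omega> p =
    (LINT y|lborel. kappa (y :: real ^ 'n)) - 2 * (LINT y|lborel. indicator (closure \<Omega>) y * kappa (p - y))"
proof -
  have [measurable]: "\<Omega> \<in> sets borel" "closure \<Omega> \<in> sets borel" using \<Omega>(1) by auto
  \<comment> \<open>The value of \<open>J\<close> at 0 is arbitrary. Written like this
    \<open>J\<close> is Borel, so that the Lebesgue integral in the curvature becomes one over
    \<open>lborel\<close>.\<close>
  have "J = (\<lambda>z. kappa z + (J 0 - phi 0) * indicator {0} z)"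
    by (rule ext) (simp add: J kappa_def indicator_def)
  moreover have "(\<lambda>z. kappa z + (J 0 - phi 0) * indicator {0 :: real ^ 'n} z) \<in> borel_measurable borel"
    by measurable
  ultimately have [measurable]: "J \<in> borel_measurable borel" by simp
  have "nonlocal_curvature J \<Omega> p =
      (LINT y|lborel. J (p - y) * (indicat_real (- \<Omega>) y - indicat_real \<Omega> y))"
    unfolding nonlocal_curvature_def by (rule integral_completion) measurable
  also have "\<dots> = (LINT y|lborel. kappa (p - y) - 2 * (indicator (closure \<Omega>) y * kappa (p - y)))"
  proof (rule integral_cong_AE)
    show "AE y in lborel. J (p - y) * (indicat_real (- \<Omega>) y - indicat_real \<Omega> y) =
        kappa (p - y) - 2 * (indicator (closure \<Omega>) y * kappa (p - y))"
      using AE_not_in[OF \<Omega>(2)] AE_lborel_singleton[of p]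
    proof eventually_elim
      case (elim y)
      have "y \<in> closure \<Omega> \<longleftrightarrow> y \<in> \<Omega>"
        using elim(1) closure_subset[of \<Omega>] \<Omega>(1) by (auto simp: frontier_def interior_open)
      moreover have "J (p - y) = kappa (p - y)" using elim(2) by (simp add: J kappa_def)
      ultimately show ?case by (simp add: indicator_def)
    qed
  qed measurable
  also have "\<dots> = (LINT y|lborel. kappa (p - y)) - 2 * (LINT y|lborel. indicator (closure \<Omega>) y * kappa (p - y))"
    using integrable_mult_indicator[of "closure \<Omega>" lborel "\<lambda>y. kappa (p - y)"]
    by (simp add: integrable_kappa)
  finally show ?thesis by (simp add: integral_kappa)
qed

end

section \<open>The two kinds of profile\<close>

lemma radial_profile_indicator:
  assumes "0 < r"
  shows "radial_profile (indicat_real {..<r}) r"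
proof
  fix \<rho> assume "\<rho> \<noteq> r"
  then have "\<rho> \<notin> frontier {..<r}" by simp
  then show "isCont (indicat_real {..<r}) \<rho>" by (rule isCont_indicator[THEN iffD2])
qed (use assms in \<open>auto simp: antimono_def indicator_def\<close>)

text \<open>Freezing the profile at its value at 0 for negative arguments makes it decreasing on the
  whole line.\<close>

lemma radial_profile_C1:
  assumes "0 < r" "C1_decreasing_profile r \<mu>" and supp: "\<And>\<rho>. r \<le> \<rho> \<Longrightarrow> \<mu> \<rho> = 0"
  shows "radial_profile (\<lambda>\<rho>. \<mu> (max 0 \<rho>)) r"
    and "radial_profile.strict (\<lambda>\<rho>. \<mu> (max 0 \<rho>)) r"
proof -
  obtain \<mu>' where deriv: "\<And>\<rho>. \<rho> \<in> {0..r} \<Longrightarrow> (\<mu> has_real_derivative \<mu>' \<rho>) (at \<rho> within {0..r})"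
    and neg: "\<And>\<rho>. \<rho> \<in> {0<..<r} \<Longrightarrow> \<mu>' \<rho> < 0"
    using assms(2) unfolding C1_decreasing_profile_def by blast
  have cont: "continuous_on {0..r} \<mu>"
    using deriv by (meson DERIV_continuous_on)
  have less: "\<mu> \<rho>\<^sub>2 < \<mu> \<rho>\<^sub>1" if "0 \<le> \<rho>\<^sub>1" "\<rho>\<^sub>1 < \<rho>\<^sub>2" "\<rho>\<^sub>2 \<le> r" for \<rho>\<^sub>1 \<rho>\<^sub>2
  proof (rule DERIV_neg_imp_decreasing_open[OF \<open>\<rho>\<^sub>1 < \<rho>\<^sub>2\<close>])
    fix \<rho> assume "\<rho>\<^sub>1 < \<rho>" "\<rho> < \<rho>\<^sub>2"
    then have "\<rho> \<in> {0<..<r}" using that by auto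
    then show "\<exists>y. (\<mu> has_real_derivative y) (at \<rho>) \<and> y < 0"
      using deriv[of \<rho>] neg[of \<rho>] at_within_Icc_at[of 0 \<rho> r] by auto
  qed (use that in \<open>auto intro: continuous_on_subset[OF cont]\<close>)
  have pos: "0 < \<mu> \<rho>" if "0 \<le> \<rho>" "\<rho> < r" for \<rho>
    using less[of \<rho> r] supp[of r] that by simp
  have strict: "\<mu> \<rho>\<^sub>2 < \<mu> \<rho>\<^sub>1" if "0 \<le> \<rho>\<^sub>1" "\<rho>\<^sub>1 < \<rho>\<^sub>2" "\<rho>\<^sub>1 < r" for \<rho>\<^sub>1 \<rho>\<^sub>2
    using less[of \<rho>\<^sub>1 \<rho>\<^sub>2] pos[of \<rho>\<^sub>1] supp[of \<rho>\<^sub>2] that by (cases "\<rho>\<^sub>2 \<le> r") auto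
  show profile: "radial_profile (\<lambda>\<rho>. \<mu> (max 0 \<rho>)) r"
  proof
    show "antimono (\<lambda>\<rho>. \<mu> (max 0 \<rho>))"
    proof (rule antimonoI)
      fix x y :: real assume "x \<le> y"
      then consider "max 0 x = max 0 y" | "max 0 x < max 0 y" "max 0 x < r" | "r \<le> max 0 x" "r \<le> max 0 y"
        by linarith
      then show "\<mu> (max 0 y) \<le> \<mu> (max 0 x)"
      proof cases
        case 2
        then show ?thesis using strict[of "max 0 x" "max 0 y"] by simp
      next
        case 3
        then show ?thesis by (simp only: supp)
      qed simp
    qed
    fix \<rho> assume "\<rho> \<noteq> r"
    show "isCont (\<lambda>\<rho>. \<mu> (max 0 \<rho>)) \<rho>"
    proof (cases "\<rho> < r")
      case True
      have "continuous_on {..<r} (\<lambda>\<rho>. \<mu> (max 0 \<rho>))"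
        by (rule continuous_on_compose2[OF cont]) (use assms(1) in \<open>auto intro!: continuous_intros\<close>)
      then show ?thesis using True by (simp add: continuous_on_eq_continuous_at)
    next
      case False
      have "continuous_on {r<..} (\<lambda>\<rho>. \<mu> (max 0 \<rho>)) \<longleftrightarrow> continuous_on {r<..} (\<lambda>\<rho>. 0 :: real)"
        by (rule continuous_on_cong) (use supp in auto)
      then show ?thesis using False \<open>\<rho> \<noteq> r\<close> by (simp add: continuous_on_eq_continuous_at)
    qed
  qed (use assms(1) supp pos in \<open>auto simp: max_def\<close>)
  show "radial_profile.strict (\<lambda>\<rho>. \<mu> (max 0 \<rho>)) r"
    unfolding radial_profile.strict_def[OF profile] using strict by auto
qed

lemma symmetric_across_if_profile:
  fixes J :: "real ^ 'n \<Rightarrow> real" and \<Omega> :: "(real ^ 'n) set" and k :: 'n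
  assumes profile: "radial_profile phi r"
    and J: "\<And>z. z \<noteq> 0 \<Longrightarrow> J z = phi (norm z)"
    and \<Omega>: "open \<Omega>" "bounded \<Omega>" "connected \<Omega>"
    and curvature_mono: "\<And>x y. x \<in> frontier \<Omega> \<Longrightarrow> y \<in> frontier \<Omega> \<Longrightarrow> hat k x = hat k y \<Longrightarrow> x $ k < y $ k \<Longrightarrow>
        (\<forall>\<theta>\<in>{0..1}. \<theta> *\<^sub>R x + (1 - \<theta>) *\<^sub>R y \<in> closure \<Omega>) \<Longrightarrow>
        nonlocal_curvature J \<Omega> x \<le> nonlocal_curvature J \<Omega> y"
    and null: "frontier \<Omega> \<in> null_sets lborel"
    and sphere: "\<And>p. \<not> radial_profile.strict phi r \<Longrightarrow> p \<in> frontier \<Omega> \<Longrightarrow> \<exists>z\<in>\<Omega>. dist p z = r"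
  shows "\<exists>l0. symmetric_across k l0 \<Omega>"
proof -
  interpret radial_profile phi r by fact
  interpret fibers "closure \<Omega>" k
    by unfold_locales (use \<Omega>(2) in \<open>simp add: compact_closure\<close>)
  interpret profile_fibers phi r "closure \<Omega>" k
  proof
    show "AE z in lborel. z \<in> closure \<Omega> \<longrightarrow> lo z < hi z"
      using AE_not_in[OF null]
    proof eventually_elim
      case (elim z)
      show ?case
      proof
        assume "z \<in> closure \<Omega>"
        then have "z \<in> \<Omega>" using elim \<Omega>(1) by (simp add: frontier_def interior_open)
        then show "lo z < hi z" using open_subset_lo_hi[OF \<Omega>(1) closure_subset, of z] by simp
      qed
    qed
  qed
  interpret nonlocal_domain phi r \<Omega> k
  proof
    fix x :: "real ^ 'n" and a b :: real
    assume ab: "a < b" "pt k x a \<in> frontier \<Omega>" "pt k x b \<in> frontier \<Omega>"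
      and seg: "\<And>s. a \<le> s \<Longrightarrow> s \<le> b \<Longrightarrow> pt k x s \<in> closure \<Omega>"
    have "\<theta> *\<^sub>R pt k x a + (1 - \<theta>) *\<^sub>R pt k x b \<in> closure \<Omega>" if "\<theta> \<in> {0..1}" for \<theta>
    proof -
      have "\<theta> *\<^sub>R pt k x a + (1 - \<theta>) *\<^sub>R pt k x b = pt k x (\<theta> * a + (1 - \<theta>) * b)"
        by (simp add: pt_def vec_eq_iff algebra_simps)
      moreover have "0 \<le> \<theta> * (b - a)" "\<theta> * (b - a) \<le> b - a"
        using that ab(1) by (auto intro: mult_left_le_one_le)
      ultimately show ?thesis using seg[of "\<theta> * a + (1 - \<theta>) * b"] by (simp add: algebra_simps)
    qed
    then have "nonlocal_curvature J \<Omega> (pt k x a) \<le> nonlocal_curvature J \<Omega> (pt k x b)"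
      using ab by (intro curvature_mono) (auto simp: hat_pt)
    then show "V (pt k x b) \<le> V (pt k x a)"
      by (simp add: nonlocal_curvature_eq[OF J \<Omega>(1) null] V_def)
  qed (use \<Omega> sphere in auto)
  obtain l where l: "\<And>x. x \<in> \<Omega> \<Longrightarrow> pt k x (2 * l - x $ k) \<in> \<Omega>"
    using reflection_symmetric by blast
  have "(\<lambda>x. join k (hat k x) (2 * l - x $ k)) ` \<Omega> = \<Omega>"
    unfolding join_hat_eq_pt
  proof
    show "\<Omega> \<subseteq> (\<lambda>x. pt k x (2 * l - x $ k)) ` \<Omega>"
    proof
      fix x assume "x \<in> \<Omega>"
      moreover have "x = pt k (pt k x (2 * l - x $ k)) (2 * l - pt k x (2 * l - x $ k) $ k)" by simp
      ultimately show "x \<in> (\<lambda>x. pt k x (2 * l - x $ k)) ` \<Omega>" using l by blast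
    qed
  qed (use l in auto)
  then show ?thesis unfolding symmetric_across_def by blast
qed

theorem theorem1p6:
  fixes J :: "real ^ 'n \<Rightarrow> real"
    and r :: real
    and \<mu> :: "real \<Rightarrow> real"
    and \<Omega> :: "(real ^ 'n) set"
    and k :: 'n
  assumes J_L1: "integrable lebesgue J"
    and r_pos: "0 < r"
    and \<mu>_nonneg: "\<And>\<rho>. 0 \<le> \<rho> \<Longrightarrow> 0 \<le> \<mu> \<rho>"
    and J_radial: "\<And>z. z \<noteq> 0 \<Longrightarrow> J z = \<mu> (norm z)"
    and \<mu>_support: "\<And>\<rho>. r \<le> \<rho> \<Longrightarrow> \<mu> \<rho> = 0"
    and \<mu>_mono: "\<And>\<rho>\<^sub>1 \<rho>\<^sub>2. 0 < \<rho>\<^sub>2 \<Longrightarrow> \<rho>\<^sub>2 < \<rho>\<^sub>1 \<Longrightarrow> \<rho>\<^sub>1 \<le> r \<Longrightarrow> \<mu> \<rho>\<^sub>1 \<le> \<mu> \<rho>\<^sub>2"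
    and cases_ab: "J = indicat_real (ball 0 r) \<or> C1_decreasing_profile r \<mu>"
    and \<Omega>_dom: "open \<Omega>" "bounded \<Omega>" "connected \<Omega>"
    and cond1: "\<And>x y. x \<in> frontier \<Omega> \<Longrightarrow> y \<in> frontier \<Omega> \<Longrightarrow> hat k x = hat k y \<Longrightarrow> x $ k < y $ k \<Longrightarrow>
        (\<forall>\<theta>\<in>{0..1}. \<theta> *\<^sub>R x + (1 - \<theta>) *\<^sub>R y \<in> closure \<Omega>) \<Longrightarrow>
        nonlocal_curvature J \<Omega> x \<le> nonlocal_curvature J \<Omega> y"
    and cond2: "hausdorff_measure CARD('n) (frontier \<Omega>) = 0"
    and cond3: "\<And>w. w \<in> hat k ` closure \<Omega> \<Longrightarrow>
        countable_union_closed_intervals {t. join k w t \<in> closure \<Omega>}"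
    and cond4: "J = indicat_real (ball 0 r) \<Longrightarrow>
        (\<forall>x\<in>frontier \<Omega>. hausdorff_measure (CARD('n) - 1) (frontier (ball x r) \<inter> \<Omega>) > 0)"
  shows "\<exists>l0. symmetric_across k l0 \<Omega>"
proof -
  have "frontier \<Omega> \<in> null_sets lborel"
    using cond2 by (intro null_sets_if_hausdorff_measure_0) (auto simp: borel_closed)
  note reflection = symmetric_across_if_profile[OF _ _ \<Omega>_dom cond1 this]
  from cases_ab show ?thesis
  proof
    assume J: "J = indicat_real (ball 0 r)"
    \<comment> \<open>Case (a) reads the profile off from \<open>J\<close> itself, since
      \<open>J\<close> leaves \<open>\<mu> 0\<close> undetermined.\<close>
    show ?thesis
    proof (rule reflection[OF radial_profile_indicator[OF r_pos]])
      fix p assume "p \<in> frontier \<Omega>"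
      then have "frontier (ball p r) \<inter> \<Omega> \<noteq> {}"
        using cond4[OF J] hausdorff_measure_empty[where 'a = "real ^ 'n"] by fastforce
      then show "\<exists>z\<in>\<Omega>. dist p z = r" using r_pos by (auto simp: frontier_ball)
    qed (auto simp: J indicator_def)
  next
    assume C1: "C1_decreasing_profile r \<mu>"
    show ?thesis
      by (rule reflection[OF radial_profile_C1(1)[OF r_pos C1 \<mu>_support]])
         (use J_radial radial_profile_C1(2)[OF r_pos C1 \<mu>_support] in auto)
  qed
qed

end
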